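(* Let $m\in\{5,6\}$ and let $\mathcal F$ be an eigenfamily of homogeneous polynomial harmonic morphisms from $\mathbb{R}^m$ to $\mathbb{C}$. If $\mathcal F$ has a uniform axis of holomorphy of real dimension at least $2$, then $\mathcal F$ is uniformly of complex type.
   Context: Polynomials $\mathbb{R}^m\to\mathbb{C}$ are polynomials in the real coordinates with complex coefficients. For polynomials, "eigenfamily" means $(0,0)$-eigenfamily: a family $\mathcal F$ of smooth functions $\mathbb{R}^m\to\mathbb{C}$ such that for all $F,G\in\mathcal F$ and all $x$: $\Delta F=0$ and $(\nabla_xF)^T\nabla_xG=0$, where $\nabla_xF=\nabla_x\operatorname{Re}F+i\nabla_x\operatorname{Im}F\in\mathbb{C}^m$ and $v^Tw=\sum_jv_jw_j$ (no conjugation). A map $F:\mathbb{R}^m\to\mathbb{C}$ is a harmonic morphism iff $\Delta F=0$ and $(\nabla_xF)^T\nabla_xF=0$ for all $x$ (so elements of an eigenfamily are automatically harmonic morphisms). For a Euclidean vector space $V$, a family $\mathcal F$ of functions $V\to\mathbb{C}$ is uniformly of complex type if there are $k\geq 0$, an orthogonal projection $\pi:V\to\mathbb{C}^k$ (i.e. the adjoint of an isometric $\mathbb{R}$-linear embedding $\mathbb{C}^k\cong\mathbb{R}^{2k}\to V$), and a family $\mathcal G$ of holomorphic maps $\mathbb{C}^k\to\mathbb{C}$ with $\mathcal F=\{G\circ\pi\mid G\in\mathcal G\}$. A vector subspace $V\subseteq\mathbb{R}^m$ is a uniform axis of holomorphy of a family $\mathcal F$ of functions $\mathbb{R}^m\to\mathbb{C}$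 if the family $\{V\to\mathbb{C},\ v\mapsto F(x+v)\mid x\in\mathbb{R}^m,F\in\mathcal F\}$ is uniformly of complex type. *)

theory Defs
  imports "HOL-Analysis.Analysis"
begin

definition partial_deriv :: "'n::finite \<Rightarrow> (real^'n \<Rightarrow> 'b::real_normed_vector) \<Rightarrow> real^'n \<Rightarrow> 'b" where
  "partial_deriv j f x = frechet_derivative f (at x) (axis j 1)"

coinductive smooth :: "(real^'n::finite \<Rightarrow> 'b::real_normed_vector) \<Rightarrow> bool" where
  "(\<forall>x. f differentiable (at x)) \<Longrightarrow> (\<forall>j. smooth (partial_deriv j f)) \<Longrightarrow> smooth f"

definition laplacian :: "(real^'n::finite \<Rightarrow> 'b::real_normed_vector) \<Rightarrow> real^'n \<Rightarrow> 'b" where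
  "laplacian f x = (\<Sum>j\<in>UNIV. partial_deriv j (partial_deriv j f) x)"

definition gradient :: "(real^'n::finite \<Rightarrow> real) \<Rightarrow> real^'n \<Rightarrow> real^'n" where
  "gradient f x = (\<chi> j. partial_deriv j f x)"

definition cgradient :: "(real^'n::finite \<Rightarrow> complex) \<Rightarrow> real^'n \<Rightarrow> complex^'n" where
  "cgradient F x =
     (\<chi> j. Complex (gradient (\<lambda>y. Re (F y)) x $ j) (gradient (\<lambda>y. Im (F y)) x $ j))"

text \<open>The complex-bilinear product without conjugation; the library's inner product on
  \<^typ>\<open>complex^'n\<close> is the real one.\<close>

definition bilinear_dot :: "complex^'n::finite \<Rightarrow> complex^'n \<Rightarrow> complex" where
  "bilinear_dot v w = (\<Sum>j\<in>UNIV. v $ j * w $ j)"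

definition harmonic_morphism :: "(real^'n::finite \<Rightarrow> complex) \<Rightarrow> bool" where
  "harmonic_morphism F \<longleftrightarrow> smooth F \<and>
     (\<forall>x. laplacian F x = 0 \<and> bilinear_dot (cgradient F x) (cgradient F x) = 0)"

text \<open>This is the case of eigenvalues \<open>(0,0)\<close>.\<close>

definition eigenfamily :: "(real^'n::finite \<Rightarrow> complex) set \<Rightarrow> bool" where
  "eigenfamily \<F> \<longleftrightarrow> (\<forall>F\<in>\<F>. smooth F) \<and>
     (\<forall>F\<in>\<F>. \<forall>G\<in>\<F>. \<forall>x. laplacian F x = 0 \<and>
        bilinear_dot (cgradient F x) (cgradient G x) = 0)"

text \<open>The sum ranges over the (finitely many) multi-indices of total degree \<open>d\<close>; the zero
  polynomial is homogeneous of every degree.\<close>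

definition homogeneous_polynomial :: "nat \<Rightarrow> (real^'n::finite \<Rightarrow> complex) \<Rightarrow> bool" where
  "homogeneous_polynomial d F \<longleftrightarrow>
     (\<exists>c :: ('n \<Rightarrow> nat) \<Rightarrow> complex. \<forall>x.
        F x = (\<Sum>\<alpha> | sum \<alpha> UNIV = d. c \<alpha> * (\<Prod>i\<in>UNIV. complex_of_real (x $ i) ^ \<alpha> i)))"

lemma finite_multi_indices: "finite {\<alpha> :: 'n::finite \<Rightarrow> nat. sum \<alpha> UNIV = d}"
proof (rule finite_subset)
  show "{\<alpha> :: 'n \<Rightarrow> nat. sum \<alpha> UNIV = d} \<subseteq> (UNIV :: 'n set) \<rightarrow>\<^sub>E {..d}"
    by (auto simp: PiE_def intro: member_le_sum)
  show "finite ((UNIV :: 'n set) \<rightarrow>\<^sub>E {..d})"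
    by (intro finite_PiE) auto
qed

text \<open>Since \<open>k\<close> is existentially quantified below, \<open>\<complex>\<^sup>k\<close> cannot be a type indexed by \<open>k\<close>; it is the
  set of sequences supported on \<open>{..<k}\<close>, with the Euclidean norm.\<close>

definition Cspace :: "nat \<Rightarrow> (nat \<Rightarrow> complex) set" where
  "Cspace k = {z. \<forall>i\<ge>k. z i = 0}"

definition Cnorm :: "nat \<Rightarrow> (nat \<Rightarrow> complex) \<Rightarrow> real" where
  "Cnorm k z = L2_set (\<lambda>i. cmod (z i)) {..<k}"

text \<open>Holomorphy on all of \<open>\<complex>\<^sup>k\<close>: at every point there is a complex-linear Frechet derivative
  \<open>h \<mapsto> \<Sum>j<k. a j * h j\<close>. Values of \<open>G\<close> outside \<^term>\<open>Cspace k\<close> are irrelevant.\<close>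

definition holomorphic_Cspace :: "nat \<Rightarrow> ((nat \<Rightarrow> complex) \<Rightarrow> complex) \<Rightarrow> bool" where
  "holomorphic_Cspace k G \<longleftrightarrow>
     (\<forall>z\<in>Cspace k. \<exists>a :: nat \<Rightarrow> complex. \<forall>e>0. \<exists>d>0. \<forall>h\<in>Cspace k. Cnorm k h < d \<longrightarrow>
        cmod (G (\<lambda>i. z i + h i) - G z - (\<Sum>j<k. a j * h j)) \<le> e * Cnorm k h)"

definition isometric_embedding :: "nat \<Rightarrow> 'a::real_inner set \<Rightarrow> ((nat \<Rightarrow> complex) \<Rightarrow> 'a) \<Rightarrow> bool" where
  "isometric_embedding k V \<iota> \<longleftrightarrow>
     (\<forall>z\<in>Cspace k. \<iota> z \<in> V \<and> norm (\<iota> z) = Cnorm k z) \<and>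
     (\<forall>z\<in>Cspace k. \<forall>w\<in>Cspace k. \<iota> (\<lambda>i. z i + w i) = \<iota> z + \<iota> w) \<and>
     (\<forall>z\<in>Cspace k. \<forall>r::real. \<iota> (\<lambda>i. r *\<^sub>R z i) = r *\<^sub>R \<iota> z)"

text \<open>The adjoint is taken with respect to the real inner product of \<open>\<complex>\<^sup>k\<close>, whose summands are the
  real inner products of the coordinates.\<close>

definition orthogonal_projection :: "'a::real_inner set \<Rightarrow> nat \<Rightarrow> ('a \<Rightarrow> nat \<Rightarrow> complex) \<Rightarrow> bool" where
  "orthogonal_projection V k \<pi> \<longleftrightarrow>
     (\<exists>\<iota>. isometric_embedding k V \<iota> \<and>
        (\<forall>v\<in>V. \<pi> v \<in> Cspace k \<and> (\<forall>z\<in>Cspace k. \<iota> z \<bullet> v = (\<Sum>j<k. z j \<bullet> \<pi> v j))))"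

text \<open>Functions \<open>V \<rightarrow> \<complex>\<close> on a subspace \<open>V\<close> are represented as functions on the ambient type made
  extensional by \<^const>\<open>restrict\<close>, which does nothing when \<open>V\<close> is the whole space.\<close>

definition uniformly_complex_type :: "'a::real_inner set \<Rightarrow> ('a \<Rightarrow> complex) set \<Rightarrow> bool" where
  "uniformly_complex_type V \<F> \<longleftrightarrow>
     (\<exists>k \<pi> \<G>. orthogonal_projection V k \<pi> \<and> (\<forall>G\<in>\<G>. holomorphic_Cspace k G) \<and>
        \<F> = {restrict (\<lambda>v. G (\<pi> v)) V | G. G \<in> \<G>})"

definition uniform_axis_of_holomorphy :: "'a::real_inner set \<Rightarrow> ('a \<Rightarrow> complex) set \<Rightarrow> bool" where
  "uniform_axis_of_holomorphy V \<F> \<longleftrightarrow> subspace V \<and>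
     uniformly_complex_type V {restrict (\<lambda>v. F (x + v)) V | x F. F \<in> \<F>}"

end

theory Submission
  imports Defs "HOL-Computational_Algebra.Polynomial"
begin

text \<open>
  A family of polynomials is uniformly of complex type as soon as the gradients of its members,
  taken at arbitrary and possibly different points, span a totally isotropic subspace of
  \<open>\<complex>\<^sup>m\<close>. The axis of holomorphy supplies orthonormal real vectors \<open>a\<close>, \<open>b\<close> with
  \<open>\<partial>\<^sub>b F = \<i> \<partial>\<^sub>a F\<close> for all members \<open>F\<close>, so that the gradients of the complexified polynomials are
  orthogonal to the null vector \<open>n = a + \<i> b\<close> and on a slice \<open>n \<bullet> x = 1\<close> only (at most) four further
  variables matter; homogeneity then spreads the isotropy from that slice to the whole space.

  In four variables, identify \<open>\<complex>\<^sup>4\<close> with \<open>\<complex>\<^sup>2 \<otimes> \<complex>\<^sup>2\<close>, the quadratic form being the determinant. Null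
  gradients are decomposable, \<open>u \<otimes> v\<close>. Differentiating \<open>\<nabla>f \<bullet> \<nabla>f = 0\<close> and using harmonicity, the Hessian
  and its square are trace free, hence it vanishes on one of the two maximal isotropic planes through
  the gradient, say the one determined by \<open>u\<close>. Then \<open>f\<close> is constant on the affine planes in these
  directions. Two such planes whose directions are independent meet, so the values of \<open>f\<close> on them
  agree; as \<open>f\<close> takes different values at generic points, the direction \<open>u\<close> is constant.
\<close>

section \<open>Polynomial functions on complex vectors\<close>

text \<open>Generation by constants, coordinates, sums and products allows the rules for derivatives
  to be proved by induction. Questions of vanishing are settled on complex lines, where such a
  function becomes a univariate \<open>poly\<close>.\<close>

inductive cpoly_fun :: "(complex^'n::finite \<Rightarrow> complex) \<Rightarrow> bool" where
  const: "cpoly_fun (\<lambda>_. c)"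
| coord: "cpoly_fun (\<lambda>x. x $ i)"
| add: "cpoly_fun f \<Longrightarrow> cpoly_fun g \<Longrightarrow> cpoly_fun (\<lambda>x. f x + g x)"
| mult: "cpoly_fun f \<Longrightarrow> cpoly_fun g \<Longrightarrow> cpoly_fun (\<lambda>x. f x * g x)"

lemma cpoly_fun_diff:
  assumes "cpoly_fun f" "cpoly_fun g"
  shows "cpoly_fun (\<lambda>x. f x - g x)"
  using cpoly_fun.add[OF assms(1) cpoly_fun.mult[OF cpoly_fun.const[of "-1"] assms(2)]] by simp

lemma cpoly_fun_power: "cpoly_fun f \<Longrightarrow> cpoly_fun (\<lambda>x. f x ^ k)"
  by (induction k) (auto intro: cpoly_fun.intros)

lemma cpoly_fun_sum: "(\<And>i. i \<in> I \<Longrightarrow> cpoly_fun (f i)) \<Longrightarrow> cpoly_fun (\<lambda>x. \<Sum>i\<in>I. f i x)"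
  by (induction I rule: infinite_finite_induct) (auto intro: cpoly_fun.intros)

lemma cpoly_fun_prod: "(\<And>i. i \<in> I \<Longrightarrow> cpoly_fun (f i)) \<Longrightarrow> cpoly_fun (\<lambda>x. \<Prod>i\<in>I. f i x)"
  by (induction I rule: infinite_finite_induct) (auto intro: cpoly_fun.intros)

lemmas cpoly_intros = cpoly_fun.intros cpoly_fun_diff cpoly_fun_power cpoly_fun_sum cpoly_fun_prod

lemma cpoly_fun_line:
  assumes "cpoly_fun f"
  shows "\<exists>p. \<forall>t. f (x + t *s h) = poly p t"
  using assms
proof induction
  case (const c)
  show ?case by (rule exI[of _ "[:c:]"]) simp
next
  case (coord i)
  show ?case by (rule exI[of _ "[:x $ i, h $ i:]"]) simp
next
  case (add f g)
  then obtain p q where "\<forall>t. f (x + t *s h) = poly p t" "\<forall>t. g (x + t *s h) = poly q t"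
    by blast
  then show ?case by (intro exI[of _ "p + q"]) simp
next
  case (mult f g)
  then obtain p q where "\<forall>t. f (x + t *s h) = poly p t" "\<forall>t. g (x + t *s h) = poly q t"
    by blast
  then show ?case by (intro exI[of _ "p * q"]) simp
qed

section \<open>Directional derivatives of polynomials\<close>

text \<open>The direction is complex, so that derivatives along null vectors such as a + \<i> b make
  sense. For polynomials the value is complex linear in \<open>h\<close>.\<close>

definition ddir :: "complex^'n::finite \<Rightarrow> (complex^'n \<Rightarrow> complex) \<Rightarrow> complex^'n \<Rightarrow> complex" where
  "ddir h f x = deriv (\<lambda>t. f (x + t *s h)) 0"

lemma ddir_line_poly:
  assumes "\<And>t. f (x + t *s h) = poly p t"
  shows "ddir h f (x + s *s h) = poly (pderiv p) s"
proof -
  have "(\<lambda>t. f (x + s *s h + t *s h)) = (\<lambda>t. poly p (s + t))"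
    by (simp add: assms [symmetric] vector_sadd_rdistrib add.assoc)
  moreover have "((\<lambda>t. poly p (s + t)) has_field_derivative poly (pderiv p) s) (at 0)"
    by (rule DERIV_cong[OF DERIV_chain2[OF poly_DERIV]]) (auto intro!: derivative_eq_intros)
  ultimately show ?thesis by (simp add: ddir_def DERIV_imp_deriv)
qed

lemma ddir_has_field_derivative:
  assumes "cpoly_fun f"
  shows "((\<lambda>t. f (x + t *s h)) has_field_derivative ddir h f (x + s *s h)) (at s)"
proof -
  obtain p where p: "\<And>t. f (x + t *s h) = poly p t" using cpoly_fun_line[OF assms] by blast
  show ?thesis using ddir_line_poly[of f, OF p] by (simp add: p poly_DERIV)
qed

lemma ddir_has_field_derivative_0:
  assumes "cpoly_fun f"
  shows "((\<lambda>t. f (x + t *s h)) has_field_derivative ddir h f x) (at 0)"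
  using ddir_has_field_derivative[OF assms, of x h 0] by simp

lemma ddir_const [simp]: "ddir h (\<lambda>x. c) = (\<lambda>x. 0)"
  by (auto simp: ddir_def)

lemma ddir_coord [simp]: "ddir h (\<lambda>x. x $ i) = (\<lambda>x. h $ i)"
proof
  fix x
  have "((\<lambda>t. (x + t *s h) $ i) has_field_derivative h $ i) (at 0)"
    by (auto intro!: derivative_eq_intros)
  then show "ddir h (\<lambda>x. x $ i) x = h $ i" unfolding ddir_def by (rule DERIV_imp_deriv)
qed

lemma ddir_add:
  assumes "cpoly_fun f" "cpoly_fun g"
  shows "ddir h (\<lambda>x. f x + g x) = (\<lambda>x. ddir h f x + ddir h g x)"
proof
  fix x
  show "ddir h (\<lambda>x. f x + g x) x = ddir h f x + ddir h g x"
    unfolding ddir_def[of h "\<lambda>x. f x + g x"]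
    by (intro DERIV_imp_deriv DERIV_add ddir_has_field_derivative_0 assms)
qed

lemma ddir_mult:
  assumes "cpoly_fun f" "cpoly_fun g"
  shows "ddir h (\<lambda>x. f x * g x) = (\<lambda>x. ddir h f x * g x + f x * ddir h g x)"
proof
  fix x
  show "ddir h (\<lambda>x. f x * g x) x = ddir h f x * g x + f x * ddir h g x"
    unfolding ddir_def[of h "\<lambda>x. f x * g x"]
    using DERIV_mult[OF ddir_has_field_derivative_0[OF assms(1), of x h]
        ddir_has_field_derivative_0[OF assms(2), of x h]]
    by (intro DERIV_imp_deriv) (simp add: algebra_simps)
qed

lemma ddir_cmult:
  assumes "cpoly_fun f"
  shows "ddir h (\<lambda>x. c * f x) = (\<lambda>x. c * ddir h f x)"
  by (simp add: ddir_mult[OF cpoly_fun.const assms])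

lemma ddir_linear:
  assumes "cpoly_fun f"
  shows "ddir (c *s h + k) f x = c * ddir h f x + ddir k f x"
  using assms
  by (induction) (auto simp: ddir_add ddir_mult algebra_simps)

lemma ddir_add_dir: "cpoly_fun f \<Longrightarrow> ddir (h + k) f x = ddir h f x + ddir k f x"
  using ddir_linear[of f 1 h k x] by simp

lemma ddir_zero_dir: "cpoly_fun f \<Longrightarrow> ddir 0 f x = 0"
  using ddir_linear[of f 1 0 0 x] by simp

lemma ddir_scale_dir: "cpoly_fun f \<Longrightarrow> ddir (c *s h) f x = c * ddir h f x"
  using ddir_linear[of f c h 0 x] by (simp add: ddir_zero_dir)

lemma ddir_diff_dir: "cpoly_fun f \<Longrightarrow> ddir (h - k) f x = ddir h f x - ddir k f x"
  using ddir_linear[of f "-1" k h x] by simp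

lemma ddir_sum_dir:
  "cpoly_fun f \<Longrightarrow> ddir (\<Sum>i\<in>I. h i) f x = (\<Sum>i\<in>I. ddir (h i) f x)"
  by (induction I rule: infinite_finite_induct) (auto simp: ddir_add_dir ddir_zero_dir)

lemma cpoly_fun_ddir: "cpoly_fun f \<Longrightarrow> cpoly_fun (ddir h f)"
  by (induction rule: cpoly_fun.induct) (auto simp: ddir_add ddir_mult intro: cpoly_fun.intros)

lemma ddir_commute:
  assumes "cpoly_fun f"
  shows "ddir h (ddir k f) = ddir k (ddir h f)"
  using assms
  by (induction)
    (auto simp: ddir_add ddir_mult cpoly_fun_ddir cpoly_fun.intros algebra_simps)

section \<open>Vanishing along lines\<close>

lemma cpoly_zero_product_line:
  assumes f: "cpoly_fun f" and g: "cpoly_fun g"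
    and "\<And>t. f (x + t *s h) * g (x + t *s h) = 0"
  shows "(\<forall>t. f (x + t *s h) = 0) \<or> (\<forall>t. g (x + t *s h) = 0)"
proof -
  obtain p where p: "\<And>t. f (x + t *s h) = poly p t" using cpoly_fun_line[OF f] by blast
  obtain q where q: "\<And>t. g (x + t *s h) = poly q t" using cpoly_fun_line[OF g] by blast
  have "poly (p * q) = poly 0" using assms(3) by (auto simp: p q)
  then have "p * q = 0" using poly_eq_poly_eq_iff by blast
  then show ?thesis by (auto simp: p q)
qed

text \<open>The line joining a point where \<open>f\<close> is nonzero to one where \<open>g\<close>
  is nonzero would carry two nonzero univariate polynomials with product zero. Hence
  \<open>S\<close> has to contain the complex line through any two of its points.\<close>

lemma cpoly_zero_product_on:
  assumes f: "cpoly_fun f" and g: "cpoly_fun g"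
    and S: "\<And>x y t. x \<in> S \<Longrightarrow> y \<in> S \<Longrightarrow> x + t *s (y - x) \<in> S"
    and fg: "\<And>x. x \<in> S \<Longrightarrow> f x * g x = 0"
  shows "(\<forall>x\<in>S. f x = 0) \<or> (\<forall>x\<in>S. g x = 0)"
proof (rule ccontr)
  assume "\<not> ?thesis"
  then obtain x y where xy: "x \<in> S" "y \<in> S" "f x \<noteq> 0" "g y \<noteq> 0" by blast
  have "f (x + t *s (y - x)) * g (x + t *s (y - x)) = 0" for t
    using fg S xy by blast
  from cpoly_zero_product_line[OF f g this]
  show False
  proof
    assume "\<forall>t. f (x + t *s (y - x)) = 0"
    from spec[OF this, of 0] show False using xy by simp
  next
    assume "\<forall>t. g (x + t *s (y - x)) = 0"
    from spec[OF this, of 1] show False using xy by simp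
  qed
qed

lemma ddir_zero_imp_constant:
  assumes f: "cpoly_fun f" and "\<And>t. ddir h f (x + t *s h) = 0"
  shows "f (x + t *s h) = f x"
proof -
  obtain p where p: "\<And>t. f (x + t *s h) = poly p t" using cpoly_fun_line[OF f] by blast
  have "poly (pderiv p) = poly 0" using ddir_line_poly[of f, OF p] assms(2) by auto
  then have "pderiv p = 0" using poly_eq_poly_eq_iff by blast
  then have "degree p = 0" by (simp add: pderiv_eq_0_iff)
  then obtain c where "p = [:c:]" by (rule degree_eq_zeroE)
  then show ?thesis using p[of t] p[of 0] by simp
qed

text \<open>Compare orders of vanishing at 0: differentiation lowers the order of a nonzero
  \<open>y\<close> by one, the factor \<open>a\<close> does not change it, and the factor
  \<open>b\<close> cannot lower it.\<close>

lemma poly_linear_ode_unique: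
  fixes y a b :: "complex poly"
  assumes "a * pderiv y = b * y" "poly a 0 \<noteq> 0" "poly y 0 = 0"
  shows "y = 0"
proof (rule ccontr)
  assume y: "y \<noteq> 0"
  have dy: "pderiv y \<noteq> 0"
  proof
    assume "pderiv y = 0"
    then have "degree y = 0" by (simp add: pderiv_eq_0_iff)
    then obtain c where "y = [:c:]" by (rule degree_eq_zeroE)
    then show False using y assms(3) by simp
  qed
  have o: "order 0 y = Suc (order 0 (pderiv y))"
    using order_pderiv[OF y assms(3)] .
  have a: "a \<noteq> 0" using assms(2) by auto
  then have "b * y \<noteq> 0" using dy assms(1) by (metis mult_eq_0_iff)
  then have "order 0 (b * y) \<ge> order 0 y" by (simp add: order_mult)
  moreover have "order 0 (a * pderiv y) = order 0 (pderiv y)"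
    using a dy assms(2) by (simp add: order_mult order_0I)
  ultimately show False using o assms(1) by simp
qed

section \<open>Harmonic polynomials with null gradient in four variables\<close>

lemma ddir_eq_product:
  assumes "cpoly_fun a" "cpoly_fun b" "cpoly_fun c" "cpoly_fun d"
    and "\<And>x. a x * b x = c x * d x"
  shows "ddir k a x * b x + a x * ddir k b x = ddir k c x * d x + c x * ddir k d x"
proof -
  have "(\<lambda>x. a x * b x) = (\<lambda>x. c x * d x)" using assms(5) by auto
  then have "ddir k (\<lambda>x. a x * b x) x = ddir k (\<lambda>x. c x * d x) x" by simp
  then show ?thesis by (simp add: ddir_mult assms(1-4))
qed

text \<open>
  The Hessian of \<open>f\<close> evaluated twice on the vector \<open>\<partial>\<^sub>k f \<cdot> h - \<partial>\<^sub>h f \<cdot> k\<close>, which is annihilated by the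
  differential of \<open>f\<close>.
\<close>

definition isotropic_hessian ::
    "complex^'n::finite \<Rightarrow> complex^'n \<Rightarrow> (complex^'n \<Rightarrow> complex) \<Rightarrow> complex^'n \<Rightarrow> complex" where
  "isotropic_hessian h k f x =
     (ddir k f x)\<^sup>2 * ddir h (ddir h f) x - 2 * ddir h f x * ddir k f x * ddir h (ddir k f) x
     + (ddir h f x)\<^sup>2 * ddir k (ddir k f) x"

lemma cpoly_fun_isotropic_hessian:
  "cpoly_fun f \<Longrightarrow> cpoly_fun (isotropic_hessian h k f)"
  unfolding isotropic_hessian_def [abs_def]
  by (intro cpoly_intros cpoly_fun_ddir)

text \<open>Here \<open>a\<close>, \<open>f2\<close>, \<open>f3\<close>, \<open>f4\<close> stand for
  first derivatives and \<open>fij\<close> for second ones, with \<open>f14\<close> also in place of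
  the equal \<open>f23\<close>. For nonzero \<open>a\<close> the gradient is a multiple of (1, v, u,
  uv), so \<open>N1\<close> to \<open>N4\<close> express \<open>f14\<close>, \<open>f24\<close>,
  \<open>f34\<close>, \<open>f44\<close> by the other second derivatives. After substitution the two
  sides of \<open>S\<close> differ by a product of two quadratic factors.\<close>

lemma isotropic_hessian_product_algebra:
  fixes a :: "'a::field"
  assumes null: "a * f4 = f2 * f3"
    and N1: "f11 * f4 + a * f14 = f12 * f3 + f2 * f13"
    and N2: "f12 * f4 + a * f24 = f22 * f3 + f2 * f14"
    and N3: "f13 * f4 + a * f34 = f14 * f3 + f2 * f33"
    and N4: "f14 * f4 + a * f44 = f24 * f3 + f2 * f34"
    and S: "f11 * f44 + 2 * f14\<^sup>2 + f22 * f33 = 2 * f12 * f34 + 2 * f13 * f24"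
  shows "(f3\<^sup>2 * f11 - 2 * a * f3 * f13 + a\<^sup>2 * f33)
       * (f2\<^sup>2 * f11 - 2 * a * f2 * f12 + a\<^sup>2 * f22) = 0"
proof (cases "a = 0")
  case True
  then show ?thesis using null by (auto simp: algebra_simps)
next
  case False
  define u v where "u = f3 / a" and "v = f2 / a"
  have f3: "f3 = a * u" and f2: "f2 = a * v" using False by (auto simp: u_def v_def)
  then have f4: "f4 = a * (u * v)" using null False by simp
  have "a * (f11 * (u * v) + f14) = a * (u * f12 + v * f13)"
    using N1 by (simp add: f2 f3 f4 algebra_simps)
  then have e14: "f14 = u * f12 + v * f13 - u * v * f11"
    unfolding mult_cancel_left using False by (auto simp: algebra_simps eq_diff_eq)
  have "a * (f12 * (u * v) + f24) = a * (u * f22 + v * f14)"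
    using N2 by (simp add: f2 f3 f4 algebra_simps)
  then have e24: "f24 = u * f22 + v * f14 - u * v * f12"
    unfolding mult_cancel_left using False by (auto simp: algebra_simps eq_diff_eq)
  have "a * (f13 * (u * v) + f34) = a * (u * f14 + v * f33)"
    using N3 by (simp add: f2 f3 f4 algebra_simps)
  then have e34: "f34 = u * f14 + v * f33 - u * v * f13"
    unfolding mult_cancel_left using False by (auto simp: algebra_simps eq_diff_eq)
  have "a * (f14 * (u * v) + f44) = a * (u * f24 + v * f34)"
    using N4 by (simp add: f2 f3 f4 algebra_simps)
  then have e44: "f44 = u * f24 + v * f34 - u * v * f14"
    unfolding mult_cancel_left using False by (auto simp: algebra_simps eq_diff_eq)
  have "(u\<^sup>2 * f11 - 2 * u * f13 + f33) * (v\<^sup>2 * f11 - 2 * v * f12 + f22)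
      = f11 * f44 + 2 * f14\<^sup>2 + f22 * f33 - (2 * f12 * f34 + 2 * f13 * f24)"
    unfolding e44 e34 e24 e14 by (simp add: power2_eq_square algebra_simps)
  then have "(u\<^sup>2 * f11 - 2 * u * f13 + f33) * (v\<^sup>2 * f11 - 2 * v * f12 + f22) = 0"
    using S by simp
  moreover have "(f3\<^sup>2 * f11 - 2 * a * f3 * f13 + a\<^sup>2 * f33)
       * (f2\<^sup>2 * f11 - 2 * a * f2 * f12 + a\<^sup>2 * f22)
     = a ^ 4 * ((u\<^sup>2 * f11 - 2 * u * f13 + f33) * (v\<^sup>2 * f11 - 2 * v * f12 + f22))"
    unfolding f2 f3 by (simp add: power2_eq_square power4_eq_xxxx algebra_simps)
  ultimately show ?thesis by simp
qed

text \<open>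
  The vectors \<open>E1, E2, E3, E4\<close> play the role of \<open>e\<^sub>i \<otimes> e\<^sub>j\<close> for \<open>ij = 00, 01, 10, 11\<close>. Exchanging \<open>E2\<close> and
  \<open>E3\<close> exchanges the two tensor factors, and thereby the two families of isotropic planes.
\<close>

locale null_harmonic =
  fixes f :: "complex^'n::finite \<Rightarrow> complex" and E1 E2 E3 E4 :: "complex^'n"
  assumes poly: "cpoly_fun f"
    and null: "ddir E1 f x * ddir E4 f x = ddir E2 f x * ddir E3 f x"
    and harmonic: "ddir E1 (ddir E4 f) x = ddir E2 (ddir E3 f) x"
begin

lemma swap: "null_harmonic f E1 E3 E2 E4"
  using poly null harmonic by unfold_locales (auto simp: mult.commute ddir_commute[OF poly])

lemma poly_intros: "cpoly_fun (ddir h f)" "cpoly_fun (ddir h (ddir k f))"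
  by (intro cpoly_fun_ddir poly)+

lemma ordered_derivs:
  "ddir E2 (ddir E1 f) = ddir E1 (ddir E2 f)"
  "ddir E3 (ddir E1 f) = ddir E1 (ddir E3 f)"
  "ddir E4 (ddir E1 f) = ddir E1 (ddir E4 f)"
  "ddir E3 (ddir E2 f) = ddir E2 (ddir E3 f)"
  "ddir E4 (ddir E2 f) = ddir E2 (ddir E4 f)"
  "ddir E4 (ddir E3 f) = ddir E3 (ddir E4 f)"
  by (rule ddir_commute[OF poly])+

lemma harmonic_fun: "ddir E2 (ddir E3 f) = ddir E1 (ddir E4 f)"
  using harmonic by auto

lemma null_deriv:
  "ddir k (ddir E1 f) x * ddir E4 f x + ddir E1 f x * ddir k (ddir E4 f) x =
   ddir k (ddir E2 f) x * ddir E3 f x + ddir E2 f x * ddir k (ddir E3 f) x"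
  by (intro ddir_eq_product poly_intros null)

lemma null_deriv2:
  "ddir h (ddir k (ddir E1 f)) x * ddir E4 f x + ddir k (ddir E1 f) x * ddir h (ddir E4 f) x
   + (ddir h (ddir E1 f) x * ddir k (ddir E4 f) x + ddir E1 f x * ddir h (ddir k (ddir E4 f)) x) =
   ddir h (ddir k (ddir E2 f)) x * ddir E3 f x + ddir k (ddir E2 f) x * ddir h (ddir E3 f) x
   + (ddir h (ddir E2 f) x * ddir k (ddir E3 f) x + ddir E2 f x * ddir h (ddir k (ddir E3 f)) x)"
proof -
  have "(\<lambda>x. ddir k (ddir E1 f) x * ddir E4 f x + ddir E1 f x * ddir k (ddir E4 f) x) =
   (\<lambda>x. ddir k (ddir E2 f) x * ddir E3 f x + ddir E2 f x * ddir k (ddir E3 f) x)"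
    by (intro ext null_deriv)
  from fun_cong[OF arg_cong[OF this, of "ddir h"], of x] show ?thesis
    by (simp add: ddir_add ddir_mult poly_intros cpoly_intros)
qed

text \<open>This says that the square of the Hessian has trace zero for the determinant form.
  Differentiate \<open>null\<close> twice, along \<open>E4\<close>, \<open>E1\<close> and along
  \<open>E3\<close>, \<open>E2\<close>: by harmonicity the terms of third order agree, and the
  difference leaves the products of second derivatives.\<close>

lemma hessian_trace_square:
  "ddir E1 (ddir E1 f) x * ddir E4 (ddir E4 f) x + 2 * (ddir E1 (ddir E4 f) x)\<^sup>2
   + ddir E2 (ddir E2 f) x * ddir E3 (ddir E3 f) x
   = 2 * ddir E1 (ddir E2 f) x * ddir E3 (ddir E4 f) x
   + 2 * ddir E1 (ddir E3 f) x * ddir E2 (ddir E4 f) x"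
proof -
  note A = null_deriv2[of E4 E1 x] and B = null_deriv2[of E3 E2 x]
  have third: "ddir E4 (ddir E1 (ddir k f)) = ddir E3 (ddir E2 (ddir k f))" for k
  proof -
    have "ddir E4 (ddir E1 (ddir k f)) = ddir k (ddir E1 (ddir E4 f))"
      by (metis ddir_commute poly poly_intros(1))
    also have "\<dots> = ddir k (ddir E2 (ddir E3 f))" by (simp add: harmonic_fun)
    also have "\<dots> = ddir E3 (ddir E2 (ddir k f))"
      by (metis ddir_commute poly poly_intros(1))
    finally show ?thesis .
  qed
  show ?thesis
    using A B unfolding third unfolding ordered_derivs harmonic_fun power2_eq_square
    by (simp add: algebra_simps) algebra
qed

lemma isotropic_hessian_product:
  "isotropic_hessian E1 E3 f x * isotropic_hessian E1 E2 f x = 0"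
  unfolding isotropic_hessian_def
  by (rule isotropic_hessian_product_algebra[where ?f4.0 = "ddir E4 f x"])
    (use null[of x] null_deriv[of E1 x] null_deriv[of E2 x] null_deriv[of E3 x]
      null_deriv[of E4 x] hessian_trace_square[of x] in \<open>simp_all add: ordered_derivs harmonic_fun\<close>)

end

text \<open>\<open>A\<close> may vanish elsewhere on the line: the orders of vanishing at the
  starting point already force \<open>Y\<close> to be zero along it.\<close>

lemma cpoly_linear_ode_line:
  assumes "cpoly_fun Y" "cpoly_fun A" "cpoly_fun B"
    and ode: "\<And>z. A z * ddir h Y z = B z * Y z" and "A x \<noteq> 0" "Y x = 0"
  shows "Y (x + t *s h) = 0"
proof -
  obtain y where y: "\<And>t. Y (x + t *s h) = poly y t" using cpoly_fun_line[OF assms(1)] by blast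
  obtain a where a: "\<And>t. A (x + t *s h) = poly a t" using cpoly_fun_line[OF assms(2)] by blast
  obtain b where b: "\<And>t. B (x + t *s h) = poly b t" using cpoly_fun_line[OF assms(3)] by blast
  have "poly (a * pderiv y) = poly (b * y)"
    using ode by (simp add: fun_eq_iff ddir_line_poly[of Y, OF y, symmetric] a[symmetric] b[symmetric] y[symmetric])
  then have "a * pderiv y = b * y" using poly_eq_poly_eq_iff by blast
  moreover have "poly a 0 \<noteq> 0" "poly y 0 = 0" using assms(5,6) a[of 0] y[of 0] by auto
  ultimately have "y = 0" by (rule poly_linear_ode_unique)
  then show ?thesis by (simp add: y)
qed

section \<open>Affine slices and the isotropic planes in them\<close>

text \<open>The four directions need not be independent. In dimension five the last frame vector is
  zero, and then \<open>E3 = - E2\<close>.\<close>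

definition slice4 :: "complex^'n::finite \<Rightarrow> complex^'n \<Rightarrow> complex^'n \<Rightarrow> complex^'n \<Rightarrow> complex^'n \<Rightarrow> (complex^'n) set"
  where "slice4 x0 E1 E2 E3 E4 = {x0 + (c1 *s E1 + c2 *s E2 + c3 *s E3 + c4 *s E4) | c1 c2 c3 c4. True}"

lemma slice4_swap: "slice4 x0 E1 E3 E2 E4 = slice4 x0 E1 E2 E3 E4"
proof -
  have "c1 *s E1 + c2 *s E3 + c3 *s E2 + c4 *s E4 = c1 *s E1 + c3 *s E2 + c2 *s E3 + c4 *s E4"
    for c1 c2 c3 c4 by (simp add: ac_simps)
  then show ?thesis unfolding slice4_def by (simp only:) blast
qed

lemma slice4_translate:
  assumes "x \<in> slice4 x0 E1 E2 E3 E4"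
  shows "x + (c1 *s E1 + c2 *s E2 + c3 *s E3 + c4 *s E4) \<in> slice4 x0 E1 E2 E3 E4"
proof -
  obtain d1 d2 d3 d4 where x: "x = x0 + (d1 *s E1 + d2 *s E2 + d3 *s E3 + d4 *s E4)"
    using assms unfolding slice4_def by blast
  show ?thesis unfolding slice4_def x
    by (rule CollectI, rule exI[of _ "d1 + c1"], rule exI[of _ "d2 + c2"],
        rule exI[of _ "d3 + c3"], rule exI[of _ "d4 + c4"])
       (simp add: vector_sadd_rdistrib)
qed

lemma slice4_diff:
  assumes "x \<in> slice4 x0 E1 E2 E3 E4" "y \<in> slice4 x0 E1 E2 E3 E4"
  obtains c1 c2 c3 c4 where "y - x = c1 *s E1 + c2 *s E2 + c3 *s E3 + c4 *s E4"
proof -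
  obtain d1 d2 d3 d4 where x: "x = x0 + (d1 *s E1 + d2 *s E2 + d3 *s E3 + d4 *s E4)"
    using assms unfolding slice4_def by blast
  obtain c1 c2 c3 c4 where y: "y = x0 + (c1 *s E1 + c2 *s E2 + c3 *s E3 + c4 *s E4)"
    using assms unfolding slice4_def by blast
  have "y - x = (c1 - d1) *s E1 + (c2 - d2) *s E2 + (c3 - d3) *s E3 + (c4 - d4) *s E4"
    unfolding x y by (simp add: vector_sub_rdistrib)
  then show thesis by (rule that)
qed

lemma slice4_line:
  assumes "x \<in> slice4 x0 E1 E2 E3 E4" "y \<in> slice4 x0 E1 E2 E3 E4"
  shows "x + t *s (y - x) \<in> slice4 x0 E1 E2 E3 E4"
proof -
  obtain c1 c2 c3 c4 where c: "y - x = c1 *s E1 + c2 *s E2 + c3 *s E3 + c4 *s E4"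
    using assms by (rule slice4_diff)
  have "x + t *s (y - x) = x + ((t * c1) *s E1 + (t * c2) *s E2 + (t * c3) *s E3 + (t * c4) *s E4)"
    unfolding c by (simp add: vector_add_ldistrib vector_smult_assoc)
  then show ?thesis using slice4_translate[OF assms(1)] by simp
qed

lemma slice4_zero_product:
  assumes "cpoly_fun f" "cpoly_fun g" "\<And>x. x \<in> slice4 x0 E1 E2 E3 E4 \<Longrightarrow> f x * g x = 0"
  shows "(\<forall>x\<in>slice4 x0 E1 E2 E3 E4. f x = 0) \<or> (\<forall>x\<in>slice4 x0 E1 E2 E3 E4. g x = 0)"
  using assms by (intro cpoly_zero_product_on slice4_line)

text \<open>The vectors (m0, m1) and (n0, n1) span the complex plane of pairs. Cramer's rule
  therefore decomposes the pairs (c1, c3) and (c2, c4) separately, and the parts along m and n are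
  the required displacements from x and y.\<close>

lemma alpha_planes_meet:
  assumes "y - x = c1 *s E1 + c2 *s E2 + c3 *s E3 + c4 *s E4" and "m0 * n1 \<noteq> (m1 * n0 :: complex)"
  obtains k0 k1 l0 l1 where
    "x + ((m0 * k0) *s E1 + (m0 * k1) *s E2 + (m1 * k0) *s E3 + (m1 * k1) *s E4) =
     y + ((n0 * l0) *s E1 + (n0 * l1) *s E2 + (n1 * l0) *s E3 + (n1 * l1) *s E4)"
proof -
  define D where "D = m1 * n0 - m0 * n1"
  have D: "D \<noteq> 0" using assms(2) by (simp add: D_def)
  define k where "k = (\<lambda>c d. (n0 * d - n1 * c) / D)"
  define l where "l = (\<lambda>c d. (m0 * d - m1 * c) / D)"
  have 1: "m0 * k c d = c + n0 * l c d" and 2: "m1 * k c d = d + n1 * l c d" for c d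
    using D unfolding k_def l_def by (simp_all add: field_simps) (simp_all add: D_def algebra_simps)
  have "y = x + (c1 *s E1 + c2 *s E2 + c3 *s E3 + c4 *s E4)"
    using assms(1) by (simp add: algebra_simps)
  then have "x + ((m0 * k c1 c3) *s E1 + (m0 * k c2 c4) *s E2 + (m1 * k c1 c3) *s E3 + (m1 * k c2 c4) *s E4) =
     y + ((n0 * l c1 c3) *s E1 + (n0 * l c2 c4) *s E2 + (n1 * l c1 c3) *s E3 + (n1 * l c2 c4) *s E4)"
    unfolding 1 2 by (simp add: vector_sadd_rdistrib)
  then show thesis by (rule that)
qed

text \<open>
  The gradients have the form \<open>u \<otimes> v(x)\<close> with \<open>u\<close> constant; the other family is obtained by
  exchanging \<open>E2\<close> and \<open>E3\<close>.
\<close>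

definition alpha_type where
  "alpha_type S E1 E2 E3 E4 f \<longleftrightarrow> (\<exists>m n. (m \<noteq> 0 \<or> n \<noteq> 0) \<and>
     (\<forall>x\<in>S. m * ddir E1 f x + n * ddir E3 f x = 0 \<and> m * ddir E2 f x + n * ddir E4 f x = 0))"

context null_harmonic
begin

text \<open>
  Along a line in the plane, the part \<open>Y\<close> of the gradient in the direction of the plane satisfies a
  linear differential equation \<open>A Y' = B Y\<close> with polynomial coefficients and \<open>Y(0) = 0 \<noteq> A(0)\<close>.
\<close>

lemma constant_on_alpha_plane:
  assumes T: "\<And>x. isotropic_hessian E1 E3 f x = 0" and fx: "ddir E1 f x \<noteq> 0"
    and m: "m0 = ddir E3 f x" "m1 = - ddir E1 f x"
  shows "f (x + ((m0 * k0) *s E1 + (m0 * k1) *s E2 + (m1 * k0) *s E3 + (m1 * k1) *s E4)) = f x"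
proof -
  define h where "h = (m0 * k0) *s E1 + (m0 * k1) *s E2 + (m1 * k0) *s E3 + (m1 * k1) *s E4"
  have ddir_h: "ddir h g z = k0 * (m0 * ddir E1 g z + m1 * ddir E3 g z)
      + k1 * (m0 * ddir E2 g z + m1 * ddir E4 g z)" if "cpoly_fun g" for g z
    unfolding h_def using that by (simp add: ddir_add_dir ddir_scale_dir algebra_simps)
  have T0: "(ddir E3 f z)\<^sup>2 * ddir E1 (ddir E1 f) z - 2 * ddir E1 f z * ddir E3 f z * ddir E1 (ddir E3 f) z
     + (ddir E1 f z)\<^sup>2 * ddir E3 (ddir E3 f) z = 0" for z
    using T[of z] unfolding isotropic_hessian_def .
  \<comment> \<open>Up to the factor \<open>ddir E1 f z\<close>, this is the Hessian on the pair f3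
    E1 - f1 E3, f3 E2 - f1 E4, where f1 and f3 are the derivatives of \<open>f\<close> along
    \<open>E1\<close> and \<open>E3\<close>. At \<open>x\<close> these two vectors span the
    plane.\<close>
  have T1: "ddir E1 f z * ((ddir E3 f z)\<^sup>2 * ddir E1 (ddir E2 f) z
      - 2 * ddir E1 f z * ddir E3 f z * ddir E1 (ddir E4 f) z
      + (ddir E1 f z)\<^sup>2 * ddir E3 (ddir E4 f) z) = 0" for z
    using T0[of z] null[of z] null_deriv[of E1 z] null_deriv[of E3 z]
    unfolding ordered_derivs harmonic_fun power2_eq_square by algebra
  define Y where "Y = (\<lambda>z. m0 * ddir E1 f z + m1 * ddir E3 f z)"
  define c1 where "c1 = (\<lambda>z. k0 * ddir E1 (ddir E1 f) z + k1 * ddir E1 (ddir E2 f) z)"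
  define c3 where "c3 = (\<lambda>z. k0 * ddir E1 (ddir E3 f) z + k1 * ddir E1 (ddir E4 f) z)"
  define A where "A = (\<lambda>z. ddir E1 f z ^ 3)"
  \<comment> \<open>\<open>B\<close> is chosen so that A Y' - B Y becomes a combination of the
    left-hand sides of \<open>T0\<close> and \<open>T1\<close>.\<close>
  define B where "B = (\<lambda>z. ddir E1 f z * (Y z * c1 z - 2 * m1 * (ddir E3 f z * c1 z - ddir E1 f z * c3 z)))"
  have pY: "cpoly_fun Y" and pA: "cpoly_fun A" and pB: "cpoly_fun B"
    unfolding Y_def A_def B_def c1_def c3_def by (intro cpoly_intros poly_intros)+
  have dY: "ddir h Y z = k0 * (m0 * (m0 * ddir E1 (ddir E1 f) z + m1 * ddir E1 (ddir E3 f) z)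
       + m1 * (m0 * ddir E1 (ddir E3 f) z + m1 * ddir E3 (ddir E3 f) z))
     + k1 * (m0 * (m0 * ddir E1 (ddir E2 f) z + m1 * ddir E1 (ddir E4 f) z)
       + m1 * (m0 * ddir E1 (ddir E4 f) z + m1 * ddir E3 (ddir E4 f) z))" for z
    unfolding ddir_h[OF pY]
    by (simp add: Y_def ddir_add ddir_cmult poly_intros cpoly_intros ordered_derivs harmonic_fun)
  have ode: "A z * ddir h Y z = B z * Y z" for z
  proof -
    have "A z * ddir h Y z - B z * Y z = m1\<^sup>2 * (k0 * ddir E1 f z *
        ((ddir E3 f z)\<^sup>2 * ddir E1 (ddir E1 f) z - 2 * ddir E1 f z * ddir E3 f z * ddir E1 (ddir E3 f) z
     + (ddir E1 f z)\<^sup>2 * ddir E3 (ddir E3 f) z) + k1 * (ddir E1 f z * ((ddir E3 f z)\<^sup>2 * ddir E1 (ddir E2 f) z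
      - 2 * ddir E1 f z * ddir E3 f z * ddir E1 (ddir E4 f) z
      + (ddir E1 f z)\<^sup>2 * ddir E3 (ddir E4 f) z)))"
      unfolding dY unfolding A_def B_def Y_def c1_def c3_def
      by (simp add: power2_eq_square power3_eq_cube algebra_simps)
    then show ?thesis unfolding T0 T1 by simp
  qed
  have Y0: "Y (x + t *s h) = 0" for t
    by (rule cpoly_linear_ode_line[OF pY pA pB ode]) (use fx in \<open>auto simp: A_def Y_def m\<close>)
  \<comment> \<open>Where \<open>Y\<close> vanishes, only the \<open>k1\<close> part of
    \<open>ddir h f\<close> remains. By \<open>null\<close>, its product with
    \<open>ddir E1 f\<close> is a multiple of \<open>Y\<close>.\<close>
  have "ddir E1 f (x + t *s h) * ddir h f (x + t *s h) = 0" for t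
  proof -
    define z where "z = x + t *s h"
    have "m0 * ddir E1 f z + m1 * ddir E3 f z = 0"
      using Y0[of t] unfolding Y_def z_def .
    then show ?thesis
      unfolding z_def[symmetric] ddir_h[OF poly] using null[of z] by algebra
  qed
  from cpoly_zero_product_line[OF poly_intros(1) poly_intros(1) this]
  have "\<forall>t. ddir h f (x + t *s h) = 0"
  proof
    assume "\<forall>t. ddir E1 f (x + t *s h) = 0"
    from spec[OF this, of 0] fx show ?thesis by simp
  qed
  then have "f (x + 1 *s h) = f x"
    using ddir_zero_imp_constant[OF poly] by blast
  then show ?thesis by (simp add: h_def)
qed

text \<open>At each point y of the slice, \<open>f y = f x\<close>, or
  \<open>ddir E1 f y = 0\<close>, or the plane at y has the direction of the plane at x; otherwise
  the planes would meet and force \<open>f x = f y\<close>. This is the vanishing of a product of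
  polynomials, of which the first two factors are not identically zero on the slice.\<close>

lemma alpha_type_if_isotropic_hessian_zero:
  assumes T: "\<And>x. isotropic_hessian E1 E3 f x = 0"
    and x: "x \<in> slice4 x0 E1 E2 E3 E4" and fx: "ddir E1 f x \<noteq> 0"
  shows "alpha_type (slice4 x0 E1 E2 E3 E4) E1 E2 E3 E4 f"
proof -
  let ?S = "slice4 x0 E1 E2 E3 E4"
  \<comment> \<open>The slope of the plane through \<open>x\<close>; the claim is that it is the
    slope on the entire slice.\<close>
  define r where "r = ddir E3 f x / ddir E1 f x"
  have prod: "(f y - f x) * (ddir E1 f y * (ddir E3 f y - r * ddir E1 f y)) = 0" if y: "y \<in> ?S" for y
  proof (rule ccontr)
    assume *: "\<not> ?thesis"
    obtain c1 c2 c3 c4 where c: "y - x = c1 *s E1 + c2 *s E2 + c3 *s E3 + c4 *s E4"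
      using x y by (rule slice4_diff)
    have "ddir E3 f x * - ddir E1 f y \<noteq> - ddir E1 f x * ddir E3 f y"
      using * fx by (auto simp: r_def field_simps)
    from alpha_planes_meet[OF c this] obtain k0 k1 l0 l1 where
      "x + ((ddir E3 f x * k0) *s E1 + (ddir E3 f x * k1) *s E2 + (- ddir E1 f x * k0) *s E3 + (- ddir E1 f x * k1) *s E4) =
       y + ((ddir E3 f y * l0) *s E1 + (ddir E3 f y * l1) *s E2 + (- ddir E1 f y * l0) *s E3 + (- ddir E1 f y * l1) *s E4)" .
    then have "f x = f y"
      using constant_on_alpha_plane[OF T fx refl refl, of k0 k1]
        constant_on_alpha_plane[OF T _ refl refl, of y l0 l1] * by auto
    with * show False by simp
  qed
  have not_const: "\<not> (\<forall>y\<in>?S. f y - f x = 0)"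
  proof
    assume c: "\<forall>y\<in>?S. f y - f x = 0"
    have "f (x + t *s E1) = f x" for t
      using slice4_translate[OF x, of t 0 0 0] c by simp
    then have "ddir E1 f x = 0" by (simp add: ddir_def)
    with fx show False by simp
  qed
  have pr: "cpoly_fun (\<lambda>y. ddir h f y - r * ddir k f y)" for h k
    by (intro cpoly_intros poly_intros)
  have cancel: "\<forall>y\<in>?S. g y = 0" if "cpoly_fun g" "\<And>y. y \<in> ?S \<Longrightarrow> ddir E1 f y * g y = 0" for g
    using slice4_zero_product[OF poly_intros(1)[of E1] that] x fx by blast
  have "(\<forall>y\<in>?S. f y - f x = 0) \<or> (\<forall>y\<in>?S. ddir E1 f y * (ddir E3 f y - r * ddir E1 f y) = 0)"
    by (intro slice4_zero_product prod cpoly_intros poly poly_intros)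
  with not_const have 3: "\<forall>y\<in>?S. ddir E3 f y - r * ddir E1 f y = 0"
    by (intro cancel pr) auto
  have 4: "\<forall>y\<in>?S. ddir E4 f y - r * ddir E2 f y = 0"
  proof (intro cancel pr)
    fix y assume "y \<in> ?S"
    then show "ddir E1 f y * (ddir E4 f y - r * ddir E2 f y) = 0"
      using 3 null[of y] by (auto simp: algebra_simps)
  qed
  show ?thesis unfolding alpha_type_def
    by (rule exI[of _ "-r"], rule exI[of _ 1]) (use 3 4 in auto)
qed

text \<open>One of the two isotropic Hessians vanishes on the whole space, which settles the case
  that \<open>ddir E1 f\<close> is nonzero somewhere on the slice. Otherwise \<open>null\<close>
  gives \<open>ddir E2 f * ddir E3 f = 0\<close> there, and a row or a column of the 2 by 2 gradient
  matrix is zero.\<close>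

lemma alpha_or_beta:
  "alpha_type (slice4 x0 E1 E2 E3 E4) E1 E2 E3 E4 f \<or> alpha_type (slice4 x0 E1 E2 E3 E4) E1 E3 E2 E4 f"
proof (cases "\<exists>x\<in>slice4 x0 E1 E2 E3 E4. ddir E1 f x \<noteq> 0")
  case True
  then obtain x where x: "x \<in> slice4 x0 E1 E2 E3 E4" "ddir E1 f x \<noteq> 0" by blast
  have "(\<forall>x\<in>UNIV. isotropic_hessian E1 E3 f x = 0) \<or> (\<forall>x\<in>UNIV. isotropic_hessian E1 E2 f x = 0)"
    by (rule cpoly_zero_product_on)
      (auto intro: cpoly_fun_isotropic_hessian poly simp: isotropic_hessian_product)
  then show ?thesis
  proof
    assume "\<forall>x\<in>UNIV. isotropic_hessian E1 E3 f x = 0"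
    then show ?thesis using alpha_type_if_isotropic_hessian_zero x by blast
  next
    assume "\<forall>x\<in>UNIV. isotropic_hessian E1 E2 f x = 0"
    then show ?thesis
      using null_harmonic.alpha_type_if_isotropic_hessian_zero[OF swap, of x x0] x
      by (auto simp: slice4_swap)
  qed
next
  case False
  then have 1: "\<forall>x\<in>slice4 x0 E1 E2 E3 E4. ddir E1 f x = 0" by blast
  then have "ddir E2 f x * ddir E3 f x = 0" if "x \<in> slice4 x0 E1 E2 E3 E4" for x
    using that null[of x] by simp
  from slice4_zero_product[OF poly_intros(1) poly_intros(1) this]
  show ?thesis
  proof
    assume "\<forall>x\<in>slice4 x0 E1 E2 E3 E4. ddir E2 f x = 0"
    then show ?thesis using 1 unfolding alpha_type_def
      by (intro disjI1 exI[of _ 1] exI[of _ 0]) auto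
  next
    assume "\<forall>x\<in>slice4 x0 E1 E2 E3 E4. ddir E3 f x = 0"
    then show ?thesis using 1 unfolding alpha_type_def
      by (intro disjI2 exI[of _ 1] exI[of _ 0]) auto
  qed
qed

end

section \<open>Gradients at two different points of a slice\<close>

text \<open>On the slice, \<open>f\<close> is invariant under translation by the directions of the
  plane. If \<open>h\<close> is a slice direction, the line through \<open>x\<close> along
  \<open>h\<close> and its translate both stay in the slice and carry the same values.\<close>

lemma ddir_alpha_plane_translate:
  assumes f: "cpoly_fun f"
    and a: "\<And>x. x \<in> slice4 x0 E1 E2 E3 E4 \<Longrightarrow>
      m * ddir E1 f x + n * ddir E3 f x = 0 \<and> m * ddir E2 f x + n * ddir E4 f x = 0"
    and x: "x \<in> slice4 x0 E1 E2 E3 E4"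
    and h: "h = c1 *s E1 + c2 *s E2 + c3 *s E3 + c4 *s E4"
  shows "ddir h f (x + ((m * k0) *s E1 + (m * k1) *s E2 + (n * k0) *s E3 + (n * k1) *s E4)) = ddir h f x"
proof -
  define v where "v = (m * k0) *s E1 + (m * k1) *s E2 + (n * k0) *s E3 + (n * k1) *s E4"
  have const: "f (y + v) = f y" if y: "y \<in> slice4 x0 E1 E2 E3 E4" for y
  proof -
    have "ddir v f (y + t *s v) = 0" for t
    proof -
      have "y + t *s v = y + ((t * (m * k0)) *s E1 + (t * (m * k1)) *s E2 + (t * (n * k0)) *s E3 + (t * (n * k1)) *s E4)"
        by (simp add: v_def vector_add_ldistrib vector_smult_assoc)
      then have "y + t *s v \<in> slice4 x0 E1 E2 E3 E4" using slice4_translate[OF y] by simp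
      moreover have "ddir v f z = k0 * (m * ddir E1 f z + n * ddir E3 f z)
          + k1 * (m * ddir E2 f z + n * ddir E4 f z)" for z
        unfolding v_def using f by (simp add: ddir_add_dir ddir_scale_dir algebra_simps)
      ultimately show ?thesis using a by simp
    qed
    from ddir_zero_imp_constant[OF f this, of 1] show ?thesis by simp
  qed
  have "f (x + v + t *s h) = f (x + t *s h)" for t
  proof -
    have "x + t *s h = x + ((t * c1) *s E1 + (t * c2) *s E2 + (t * c3) *s E3 + (t * c4) *s E4)"
      by (simp add: h vector_add_ldistrib vector_smult_assoc)
    then have "x + t *s h \<in> slice4 x0 E1 E2 E3 E4" using slice4_translate[OF x] by simp
    from const[OF this] show ?thesis by (simp add: ac_simps)
  qed
  then show ?thesis unfolding v_def[symmetric] ddir_def by simp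
qed

text \<open>The polarised determinant form, applied to the gradients of \<open>f\<close> at
  \<open>x\<close> and of \<open>g\<close> at \<open>y\<close>. The hypotheses on a family control
  it for \<open>x = y\<close>; isotropy of the span of all gradients requires it for independent
  points.\<close>

definition null_pairing where
  "null_pairing E1 E2 E3 E4 f g x y = ddir E1 f x * ddir E4 g y + ddir E4 f x * ddir E1 g y
     - ddir E2 f x * ddir E3 g y - ddir E3 f x * ddir E2 g y"

lemma null_pairing_swap: "null_pairing E1 E3 E2 E4 f g = null_pairing E1 E2 E3 E4 f g"
  by (auto simp: null_pairing_def fun_eq_iff)

lemma null_pairing_commute: "null_pairing E1 E2 E3 E4 f g x y = null_pairing E1 E2 E3 E4 g f y x"
  by (auto simp: null_pairing_def)

text \<open>A solution (a, c) is a multiple of (- m1, m0). The multiplier is linear in a and c with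
  fixed coefficients, hence polynomial when a and c are polynomials.\<close>

lemma split_null_row:
  fixes m0 m1 :: "'a::field"
  assumes "m0 \<noteq> 0 \<or> m1 \<noteq> 0"
  obtains s0 s1 where "\<And>a c. m0 * a + m1 * c = 0 \<Longrightarrow> a = - m1 * (s0 * a + s1 * c)"
    "\<And>a c. m0 * a + m1 * c = 0 \<Longrightarrow> c = m0 * (s0 * a + s1 * c)"
proof (cases "m0 = 0")
  case True
  then show thesis using assms by (intro that[of "- 1 / m1" 0]) auto
next
  case False
  show thesis
  proof (rule that[of 0 "1 / m0"])
    fix a c assume "m0 * a + m1 * c = 0"
    then have "m0 * a = - m1 * c" by (simp add: eq_neg_iff_add_eq_0)
    then show "a = - m1 * (0 * a + 1 / m0 * c)" "c = m0 * (0 * a + 1 / m0 * c)"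
      using False by (simp_all add: field_simps)
  qed
qed

lemma alpha_type_obtain:
  assumes f: "cpoly_fun f" and "alpha_type (slice4 x0 E1 E2 E3 E4) E1 E2 E3 E4 f"
  obtains m0 m1 a b where "cpoly_fun a" "cpoly_fun b"
    "\<And>x. x \<in> slice4 x0 E1 E2 E3 E4 \<Longrightarrow>
      ddir E1 f x = - m1 * a x \<and> ddir E2 f x = - m1 * b x \<and> ddir E3 f x = m0 * a x \<and> ddir E4 f x = m0 * b x"
    "\<And>x. x \<in> slice4 x0 E1 E2 E3 E4 \<Longrightarrow>
      m0 * ddir E1 f x + m1 * ddir E3 f x = 0 \<and> m0 * ddir E2 f x + m1 * ddir E4 f x = 0"
proof -
  let ?S = "slice4 x0 E1 E2 E3 E4"
  obtain m0 m1 where m: "m0 \<noteq> 0 \<or> m1 \<noteq> 0" and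
    mf: "\<And>x. x \<in> ?S \<Longrightarrow> m0 * ddir E1 f x + m1 * ddir E3 f x = 0 \<and> m0 * ddir E2 f x + m1 * ddir E4 f x = 0"
    using assms(2) unfolding alpha_type_def by blast
  obtain s0 s1 where s: "\<And>a c. m0 * a + m1 * c = 0 \<Longrightarrow> a = - m1 * (s0 * a + s1 * c)"
    "\<And>a c. m0 * a + m1 * c = 0 \<Longrightarrow> c = m0 * (s0 * a + s1 * c)"
    using m by (rule split_null_row) (rule that)
  show thesis
  proof (rule that[OF _ _ _ mf])
    show "cpoly_fun (\<lambda>x. s0 * ddir E1 f x + s1 * ddir E3 f x)"
      "cpoly_fun (\<lambda>x. s0 * ddir E2 f x + s1 * ddir E4 f x)"
      by (intro cpoly_intros cpoly_fun_ddir f)+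
    show "ddir E1 f x = - m1 * (s0 * ddir E1 f x + s1 * ddir E3 f x) \<and>
        ddir E2 f x = - m1 * (s0 * ddir E2 f x + s1 * ddir E4 f x) \<and>
        ddir E3 f x = m0 * (s0 * ddir E1 f x + s1 * ddir E3 f x) \<and>
        ddir E4 f x = m0 * (s0 * ddir E2 f x + s1 * ddir E4 f x)" if "x \<in> ?S" for x
      using mf[OF that] by (intro conjI s) auto
  qed
qed

text \<open>If the two constant directions are proportional, the pairing has the factor
  \<open>m0 * n1 - m1 * n0 = 0\<close>. Otherwise the plane of \<open>f\<close> through
  \<open>x\<close> meets that of \<open>g\<close> through \<open>y\<close> in a point
  \<open>z\<close>, whose gradients are those of \<open>f\<close> at \<open>x\<close> and of
  \<open>g\<close> at \<open>y\<close>; then \<open>diag\<close> applies at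
  \<open>z\<close>.\<close>

lemma null_pairing_alpha_alpha:
  assumes f: "cpoly_fun f" and g: "cpoly_fun g"
    and af: "alpha_type (slice4 x0 E1 E2 E3 E4) E1 E2 E3 E4 f"
    and ag: "alpha_type (slice4 x0 E1 E2 E3 E4) E1 E2 E3 E4 g"
    and diag: "\<And>x. null_pairing E1 E2 E3 E4 f g x x = 0"
    and x: "x \<in> slice4 x0 E1 E2 E3 E4" and y: "y \<in> slice4 x0 E1 E2 E3 E4"
  shows "null_pairing E1 E2 E3 E4 f g x y = 0"
proof -
  let ?S = "slice4 x0 E1 E2 E3 E4"
  obtain m0 m1 a b where
    m: "\<And>x. x \<in> ?S \<Longrightarrow> ddir E1 f x = - m1 * a x \<and> ddir E2 f x = - m1 * b x \<and>
      ddir E3 f x = m0 * a x \<and> ddir E4 f x = m0 * b x" and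
    mf: "\<And>x. x \<in> ?S \<Longrightarrow> m0 * ddir E1 f x + m1 * ddir E3 f x = 0 \<and> m0 * ddir E2 f x + m1 * ddir E4 f x = 0"
    using f af by (rule alpha_type_obtain) (rule that)
  obtain n0 n1 c d where
    n: "\<And>x. x \<in> ?S \<Longrightarrow> ddir E1 g x = - n1 * c x \<and> ddir E2 g x = - n1 * d x \<and>
      ddir E3 g x = n0 * c x \<and> ddir E4 g x = n0 * d x" and
    ng: "\<And>x. x \<in> ?S \<Longrightarrow> n0 * ddir E1 g x + n1 * ddir E3 g x = 0 \<and> n0 * ddir E2 g x + n1 * ddir E4 g x = 0"
    using g ag by (rule alpha_type_obtain) (rule that)
  show ?thesis
  proof (cases "m0 * n1 = m1 * n0")
    case True
    have "null_pairing E1 E2 E3 E4 f g x y = (m0 * n1 - m1 * n0) * (a x * d y - b x * c y)"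
      using m[OF x] n[OF y] by (simp add: null_pairing_def algebra_simps)
    then show ?thesis using True by simp
  next
    case False
    obtain c1 c2 c3 c4 where diff: "y - x = c1 *s E1 + c2 *s E2 + c3 *s E3 + c4 *s E4"
      using x y by (rule slice4_diff)
    obtain k0 k1 l0 l1 where e:
      "x + ((m0 * k0) *s E1 + (m0 * k1) *s E2 + (m1 * k0) *s E3 + (m1 * k1) *s E4) =
       y + ((n0 * l0) *s E1 + (n0 * l1) *s E2 + (n1 * l0) *s E3 + (n1 * l1) *s E4)"
      using diff False by (rule alpha_planes_meet)
    define z where "z = x + ((m0 * k0) *s E1 + (m0 * k1) *s E2 + (m1 * k0) *s E3 + (m1 * k1) *s E4)"
    have tf: "ddir (c1 *s E1 + c2 *s E2 + c3 *s E3 + c4 *s E4) f z =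
        ddir (c1 *s E1 + c2 *s E2 + c3 *s E3 + c4 *s E4) f x" for c1 c2 c3 c4
      unfolding z_def by (rule ddir_alpha_plane_translate[OF f mf x refl])
    have tg: "ddir (c1 *s E1 + c2 *s E2 + c3 *s E3 + c4 *s E4) g z =
        ddir (c1 *s E1 + c2 *s E2 + c3 *s E3 + c4 *s E4) g y" for c1 c2 c3 c4
      unfolding z_def e by (rule ddir_alpha_plane_translate[OF g ng y refl])
    have "null_pairing E1 E2 E3 E4 f g x y = null_pairing E1 E2 E3 E4 f g z z"
      using tf[of 1 0 0 0] tf[of 0 1 0 0] tf[of 0 0 1 0] tf[of 0 0 0 1]
        tg[of 1 0 0 0] tg[of 0 1 0 0] tg[of 0 0 1 0] tg[of 0 0 0 1]
      by (simp add: null_pairing_def)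
    then show ?thesis using diag by simp
  qed
qed

text \<open>For opposite families the pairing splits as - A(x) B(y). On the diagonal the product of
  the two polynomials vanishes, so one of them is zero on the slice.\<close>

lemma null_pairing_alpha_beta:
  assumes f: "cpoly_fun f" and g: "cpoly_fun g"
    and af: "alpha_type (slice4 x0 E1 E2 E3 E4) E1 E2 E3 E4 f"
    and bg: "alpha_type (slice4 x0 E1 E2 E3 E4) E1 E3 E2 E4 g"
    and diag: "\<And>x. null_pairing E1 E2 E3 E4 f g x x = 0"
    and x: "x \<in> slice4 x0 E1 E2 E3 E4" and y: "y \<in> slice4 x0 E1 E2 E3 E4"
  shows "null_pairing E1 E2 E3 E4 f g x y = 0"
proof -
  let ?S = "slice4 x0 E1 E2 E3 E4"
  obtain m0 m1 a b where ab: "cpoly_fun a" "cpoly_fun b" and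
    m: "\<And>x. x \<in> ?S \<Longrightarrow> ddir E1 f x = - m1 * a x \<and> ddir E2 f x = - m1 * b x \<and>
      ddir E3 f x = m0 * a x \<and> ddir E4 f x = m0 * b x"
    using f af by (rule alpha_type_obtain) (rule that)
  have sw: "slice4 x0 E1 E3 E2 E4 = ?S" by (rule slice4_swap)
  have bg': "alpha_type (slice4 x0 E1 E3 E2 E4) E1 E3 E2 E4 g" using bg by (simp only: sw)
  obtain n0 n1 c d where cd: "cpoly_fun c" "cpoly_fun d" and
    n: "\<And>x. x \<in> ?S \<Longrightarrow> ddir E1 g x = - n1 * c x \<and> ddir E3 g x = - n1 * d x \<and>
      ddir E2 g x = n0 * c x \<and> ddir E4 g x = n0 * d x"
    using g bg' by (rule alpha_type_obtain[of g x0 E1 E3 E2 E4]) (rule that, simp_all only: sw)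
  define A where "A = (\<lambda>x. n0 * a x + n1 * b x)"
  define B where "B = (\<lambda>x. m0 * c x + m1 * d x)"
  have factor: "null_pairing E1 E2 E3 E4 f g x y = - (A x * B y)" if "x \<in> ?S" "y \<in> ?S" for x y
    using m[OF that(1)] n[OF that(2)] by (simp add: null_pairing_def A_def B_def algebra_simps)
  have "A z * B z = 0" if "z \<in> ?S" for z using factor[OF that that] diag by simp
  then have "(\<forall>z\<in>?S. A z = 0) \<or> (\<forall>z\<in>?S. B z = 0)"
    by (intro slice4_zero_product) (auto simp: A_def B_def intro!: cpoly_intros ab cd)
  then show ?thesis using factor[OF x y] x y by auto
qed

theorem null_pairing_zero_on_slice:
  assumes f: "null_harmonic f E1 E2 E3 E4" and g: "null_harmonic g E1 E2 E3 E4"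
    and diag: "\<And>x. null_pairing E1 E2 E3 E4 f g x x = 0"
    and x: "x \<in> slice4 x0 E1 E2 E3 E4" and y: "y \<in> slice4 x0 E1 E2 E3 E4"
  shows "null_pairing E1 E2 E3 E4 f g x y = 0"
proof -
  note pf = null_harmonic.poly[OF f] and pg = null_harmonic.poly[OF g]
  have diag': "null_pairing E1 E2 E3 E4 g f z z = 0" for z
    using diag[of z] null_pairing_commute[of E1 E2 E3 E4 g f z z] by simp
  have diag_sw: "null_pairing E1 E3 E2 E4 f g z z = 0" for z
    using diag[of z] by (simp only: null_pairing_swap[of E1 E3 E2 E4])
  let ?S = "slice4 x0 E1 E2 E3 E4"
  consider "alpha_type ?S E1 E2 E3 E4 f" "alpha_type ?S E1 E2 E3 E4 g"
    | "alpha_type ?S E1 E2 E3 E4 f" "alpha_type ?S E1 E3 E2 E4 g"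
    | "alpha_type ?S E1 E3 E2 E4 f" "alpha_type ?S E1 E2 E3 E4 g"
    | "alpha_type ?S E1 E3 E2 E4 f" "alpha_type ?S E1 E3 E2 E4 g"
    using null_harmonic.alpha_or_beta[OF f, of x0] null_harmonic.alpha_or_beta[OF g, of x0] by blast
  then show ?thesis
  proof cases
    case 1
    show ?thesis by (rule null_pairing_alpha_alpha[OF pf pg 1 diag x y])
  next
    case 2
    show ?thesis by (rule null_pairing_alpha_beta[OF pf pg 2 diag x y])
  next
    case 3
    show ?thesis
      unfolding null_pairing_commute[of _ _ _ _ f g x y]
      by (rule null_pairing_alpha_beta[OF pg pf 3(2,1) diag' y x])
  next
    case 4
    have "null_pairing E1 E3 E2 E4 f g x y = 0"
    proof (rule null_pairing_alpha_alpha[OF pf pg _ _ diag_sw])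
      have sw: "slice4 x0 E1 E3 E2 E4 = ?S" by (rule slice4_swap)
      show "alpha_type (slice4 x0 E1 E3 E2 E4) E1 E3 E2 E4 f" "alpha_type (slice4 x0 E1 E3 E2 E4) E1 E3 E2 E4 g"
        "x \<in> slice4 x0 E1 E3 E2 E4" "y \<in> slice4 x0 E1 E3 E2 E4"
        using 4 x y by (simp_all only: sw)
    qed
    then show ?thesis by (simp only: null_pairing_swap[of E1 E3 E2 E4])
  qed
qed

section \<open>Complexification of real polynomials\<close>

definition cvec :: "real^'n \<Rightarrow> complex^'n" where
  "cvec x = (\<chi> i. complex_of_real (x $ i))"

lemma cvec_nth [simp]: "cvec x $ i = complex_of_real (x $ i)"
  by (simp add: cvec_def)

lemma cvec_axis: "cvec (axis j 1) = axis j 1"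
  by (simp add: vec_eq_iff axis_def)

lemma cvec_add: "cvec (x + y) = cvec x + cvec y"
  by (simp add: vec_eq_iff)

lemma cvec_scaleR: "cvec (t *\<^sub>R x) = complex_of_real t *s cvec x"
  by (simp add: vec_eq_iff)

lemma homogeneous_polynomial_complexify:
  assumes "homogeneous_polynomial d F"
  obtains f where "cpoly_fun f" "F = (\<lambda>x. f (cvec x))" "\<And>t z. f (t *s z) = t ^ d * f z"
proof -
  obtain c where c: "\<And>x. F x = (\<Sum>\<alpha> | sum \<alpha> UNIV = d. c \<alpha> * (\<Prod>i\<in>UNIV. complex_of_real (x $ i) ^ \<alpha> i))"
    using assms unfolding homogeneous_polynomial_def by blast
  define f where "f = (\<lambda>z :: complex^'a. \<Sum>\<alpha> | sum \<alpha> UNIV = d. c \<alpha> * (\<Prod>i\<in>UNIV. (z $ i) ^ \<alpha> i))"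
  have "cpoly_fun f" unfolding f_def by (intro cpoly_intros)
  moreover have "F = (\<lambda>x. f (cvec x))" by (simp add: f_def c fun_eq_iff)
  moreover have "f (t *s z) = t ^ d * f z" for t z
    unfolding f_def sum_distrib_left
    by (intro sum.cong refl) (auto simp: power_mult_distrib prod.distrib power_sum[symmetric])
  ultimately show thesis by (rule that)
qed

lemma cpoly_fun_has_derivative:
  assumes "cpoly_fun f"
  shows "((\<lambda>x. f (cvec x)) has_derivative (\<lambda>h. ddir (cvec h) f (cvec x))) (at x)"
  using assms
proof induction
  case (coord i)
  have "((\<lambda>x. complex_of_real (x $ i)) has_derivative (\<lambda>h. complex_of_real (h $ i))) (at x)"
    by (intro bounded_linear_imp_has_derivative
        bounded_linear_compose[OF bounded_linear_of_real bounded_linear_vec_nth])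
  then show ?case by simp
qed (auto simp: ddir_add ddir_mult intro!: derivative_eq_intros)

lemma partial_deriv_cpoly:
  assumes "cpoly_fun f"
  shows "partial_deriv j (\<lambda>x. f (cvec x)) = (\<lambda>x. ddir (axis j 1) f (cvec x))"
proof
  fix x
  show "partial_deriv j (\<lambda>x. f (cvec x)) x = ddir (axis j 1) f (cvec x)"
    unfolding partial_deriv_def frechet_derivative_at[OF cpoly_fun_has_derivative[OF assms], symmetric]
    by (simp add: cvec_axis)
qed

lemma laplacian_cpoly:
  assumes "cpoly_fun f"
  shows "laplacian (\<lambda>x. f (cvec x)) x = (\<Sum>j\<in>UNIV. ddir (axis j 1) (ddir (axis j 1) f) (cvec x))"
  unfolding laplacian_def by (simp add: partial_deriv_cpoly assms cpoly_fun_ddir)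

lemma cgradient_cpoly:
  assumes "cpoly_fun f"
  shows "cgradient (\<lambda>x. f (cvec x)) x = (\<chi> j. ddir (axis j 1) f (cvec x))"
proof -
  note D = cpoly_fun_has_derivative[OF assms, of x]
  have "partial_deriv j (\<lambda>x. Re (f (cvec x))) x = Re (ddir (axis j 1) f (cvec x))" for j
    unfolding partial_deriv_def frechet_derivative_at[OF has_derivative_Re[OF D], symmetric]
    by (simp add: cvec_axis)
  moreover have "partial_deriv j (\<lambda>x. Im (f (cvec x))) x = Im (ddir (axis j 1) f (cvec x))" for j
    unfolding partial_deriv_def frechet_derivative_at[OF has_derivative_Im[OF D], symmetric]
    by (simp add: cvec_axis)
  ultimately show ?thesis unfolding cgradient_def gradient_def by simp
qed

text \<open>With z = x + \<i> y for real x and y, the polynomial t \<mapsto> f (x + t y) has every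
  real number as a root, hence is zero and vanishes at t = \<i>.\<close>

lemma cpoly_zero_if_zero_on_reals:
  assumes f: "cpoly_fun f" and zero: "\<And>x. f (cvec x) = 0"
  shows "f z = 0"
proof -
  define x y where "x = (\<chi> i. Re (z $ i))" and "y = (\<chi> i. Im (z $ i))"
  obtain p where p: "\<And>t. f (cvec x + t *s cvec y) = poly p t" using cpoly_fun_line[OF f] by blast
  have "poly p (complex_of_real t) = 0" for t
    using zero[of "x + t *\<^sub>R y"] by (simp add: p[symmetric] cvec_add cvec_scaleR)
  then have "range complex_of_real \<subseteq> {t. poly p t = 0}" by auto
  moreover have "infinite (range complex_of_real)"
    using finite_imageD[of complex_of_real UNIV] by (auto simp: inj_on_def infinite_UNIV_char_0)
  ultimately have "p = 0" using poly_roots_finite finite_subset by blast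
  moreover have "z = cvec x + \<i> *s cvec y"
    by (auto simp: vec_eq_iff x_def y_def complex_eq_iff)
  ultimately show ?thesis using p[of \<i>] by simp
qed

lemma ddir_expand:
  assumes "cpoly_fun f"
  shows "ddir h f z = (\<Sum>j\<in>UNIV. h $ j * ddir (axis j 1) f z)"
proof -
  have "ddir h f z = ddir (\<Sum>j\<in>UNIV. h $ j *s axis j 1) f z" by (simp only: basis_expansion)
  also have "\<dots> = (\<Sum>j\<in>UNIV. h $ j * ddir (axis j 1) f z)"
    using assms by (simp add: ddir_sum_dir ddir_scale_dir)
  finally show ?thesis .
qed

definition grad_pairing where
  "grad_pairing f g z w = (\<Sum>j\<in>UNIV. ddir (axis j 1) f z * ddir (axis j 1) g w)"

lemma cpoly_fun_grad_pairing:
  assumes "cpoly_fun f" "cpoly_fun g"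
  shows "cpoly_fun (\<lambda>z. grad_pairing f g z w)" "cpoly_fun (\<lambda>w. grad_pairing f g z w)"
    "cpoly_fun (\<lambda>z. grad_pairing f g z z)"
  unfolding grad_pairing_def by (intro cpoly_intros cpoly_fun_ddir assms)+

lemma eigenfamily_complexify:
  assumes "eigenfamily \<F>" "F \<in> \<F>" "G \<in> \<F>"
    and f: "cpoly_fun f" "F = (\<lambda>x. f (cvec x))" and g: "cpoly_fun g" "G = (\<lambda>x. g (cvec x))"
  shows "grad_pairing f g z z = 0" "(\<Sum>j\<in>UNIV. ddir (axis j 1) (ddir (axis j 1) f) z) = 0"
proof -
  have "laplacian F x = 0" "bilinear_dot (cgradient F x) (cgradient G x) = 0" for x
    using assms(1-3) unfolding eigenfamily_def by blast+
  then have *: "(\<Sum>j\<in>UNIV. ddir (axis j 1) (ddir (axis j 1) f) (cvec x)) = 0"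
    "grad_pairing f g (cvec x) (cvec x) = 0" for x
    unfolding f(2) g(2) laplacian_cpoly[OF f(1)] cgradient_cpoly[OF f(1)] cgradient_cpoly[OF g(1)]
      bilinear_dot_def grad_pairing_def by simp_all
  show "(\<Sum>j\<in>UNIV. ddir (axis j 1) (ddir (axis j 1) f) z) = 0"
    by (rule cpoly_zero_if_zero_on_reals[where f = "\<lambda>z. \<Sum>j\<in>UNIV. ddir (axis j 1) (ddir (axis j 1) f) z"])
      (intro cpoly_intros cpoly_fun_ddir f *)+
  show "grad_pairing f g z z = 0"
    by (rule cpoly_zero_if_zero_on_reals[where f = "\<lambda>z. grad_pairing f g z z"])
      (rule cpoly_fun_grad_pairing f g *)+
qed

section \<open>Orthonormal frames containing the two axis vectors\<close>

lemma orthonormal_span_expand: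
  fixes y :: "'a::euclidean_space"
  assumes "pairwise orthogonal B" "\<And>x. x \<in> B \<Longrightarrow> norm x = 1" and y: "y \<in> span B"
  shows "y = (\<Sum>e\<in>B. (e \<bullet> y) *\<^sub>R e)"
proof -
  have fin: "finite B" using pairwise_orthogonal_imp_finite[OF assms(1)] .
  define r where "r = y - (\<Sum>e\<in>B. (e \<bullet> y) *\<^sub>R e)"
  have "r \<in> span B" unfolding r_def
    by (intro span_diff y span_sum span_scale span_base)
  moreover have "orthogonal r e" if e: "e \<in> B" for e
  proof -
    have "(\<Sum>u\<in>B. (u \<bullet> y) *\<^sub>R u) \<bullet> e = (\<Sum>u\<in>B. if u = e then e \<bullet> y else 0)"
      unfolding inner_sum_left using assms e
      by (intro sum.cong refl) (auto simp: pairwise_def orthogonal_def dot_square_norm)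
    also have "\<dots> = e \<bullet> y" using fin e by simp
    finally show ?thesis by (simp add: orthogonal_def r_def inner_diff_left inner_diff_right inner_commute)
  qed
  ultimately have "orthogonal r r" by (metis orthogonal_to_span)
  then show ?thesis by (simp add: r_def orthogonal_self)
qed

text \<open>In dimension five the fourth vector is zero.\<close>

lemma orthonormal_frame:
  fixes a b :: "real^'n"
  assumes card: "CARD('n) \<in> {5, 6}" and a: "norm a = 1" and b: "norm b = 1" and ab: "a \<bullet> b = 0"
  obtains e1 e2 e3 e4 :: "real^'n" where
    "\<And>j l. a $ j * a $ l + b $ j * b $ l + e1 $ j * e1 $ l + e2 $ j * e2 $ l + e3 $ j * e3 $ l + e4 $ j * e4 $ l
      = (if j = l then 1 else 0)"
proof -
  define Q where "Q = {x. a \<bullet> x = 0 \<and> b \<bullet> x = 0}"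
  have "subspace Q" unfolding Q_def by (auto simp: subspace_def inner_add_right)
  then obtain B where BQ: "B \<subseteq> Q" and orth: "pairwise orthogonal B"
    and norm: "\<And>x. x \<in> B \<Longrightarrow> norm x = 1" and sp: "span B = Q"
    by (rule orthonormal_basis_subspace) (rule that)
  have aa: "a \<bullet> a = 1" and bb: "b \<bullet> b = 1" using a b by (simp_all add: dot_square_norm)
  have fin: "finite B" using pairwise_orthogonal_imp_finite[OF orth] .
  have notin: "a \<notin> B" "b \<notin> B" "a \<noteq> b" using BQ aa bb ab by (auto simp: Q_def)
  have expand: "x = (a \<bullet> x) *\<^sub>R a + (b \<bullet> x) *\<^sub>R b + (\<Sum>e\<in>B. (e \<bullet> x) *\<^sub>R e)" for x
  proof -
    define y where "y = x - (a \<bullet> x) *\<^sub>R a - (b \<bullet> x) *\<^sub>R b"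
    have "y \<in> Q" using aa bb ab by (simp add: Q_def y_def inner_diff_right inner_commute)
    then have "y \<in> span B" by (simp add: sp)
    then have "y = (\<Sum>e\<in>B. (e \<bullet> y) *\<^sub>R e)"
      by (intro orthonormal_span_expand orth norm)
    also have "\<dots> = (\<Sum>e\<in>B. (e \<bullet> x) *\<^sub>R e)"
      using BQ by (intro sum.cong refl) (auto simp: Q_def y_def inner_diff_right inner_commute subset_iff)
    finally show ?thesis unfolding y_def by (simp add: algebra_simps)
  qed
  \<comment> \<open>Coordinate \<open>l\<close> of the expansion of \<open>axis j 1\<close>.\<close>
  have parseval: "a $ j * a $ l + b $ j * b $ l + (\<Sum>e\<in>B. e $ j * e $ l) = (if j = l then 1 else 0)" for j l
  proof -
    have "axis j 1 $ l = a $ j * a $ l + b $ j * b $ l + (\<Sum>e\<in>B. e $ j * e $ l)"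
      by (subst expand) (simp add: inner_axis)
    then show ?thesis by (auto simp: axis_def)
  qed
  \<comment> \<open>Adding \<open>a\<close> and \<open>b\<close> gives a basis of the whole space,
    so \<open>B\<close> has \<open>CARD('n) - 2\<close> elements.\<close>
  define B' where "B' = insert a (insert b B)"
  have "pairwise orthogonal B'" unfolding B'_def pairwise_insert
    using orth BQ ab by (auto simp: orthogonal_def Q_def inner_commute)
  moreover have "0 \<notin> B'" using a b norm[of 0] by (auto simp: B'_def)
  ultimately have "independent B'" by (rule pairwise_orthogonal_independent)
  moreover have "span B' = UNIV"
  proof -
    have "x \<in> span B'" for x
      by (subst expand) (intro span_add span_scale span_sum span_base; simp add: B'_def)
    then show ?thesis by auto
  qed
  ultimately have "card B' = CARD('n)"
    using dim_eq_card_independent[of B'] dim_span[of B'] by simp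
  then have "card B = 3 \<or> card B = 4" using card fin notin by (auto simp: B'_def)
  then show thesis
  proof
    assume "card B = 3"
    then obtain e1 e2 e3 where "B = {e1, e2, e3}" "e1 \<noteq> e2" "e1 \<noteq> e3" "e2 \<noteq> e3"
      by (metis card_3_iff)
    then show thesis using parseval by (intro that[of e1 e2 e3 0]) (simp add: add.assoc)
  next
    assume "card B = 4"
    then have "card B = Suc 3" by simp
    then obtain e4 B3 where B3: "B = insert e4 B3" "e4 \<notin> B3" "card B3 = 3"
      by (blast dest: card_eq_SucD)
    then obtain e1 e2 e3 where "B3 = {e1, e2, e3}" "e1 \<noteq> e2" "e1 \<noteq> e3" "e2 \<noteq> e3"
      by (metis card_3_iff)
    then show thesis using parseval B3
      by (intro that[of e4 e1 e2 e3]) (auto simp: add.assoc)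
  qed
qed

text \<open>The six vectors resolve the identity matrix, so contracting \<open>M\<close> with them
  gives its trace, even when one of them is zero. Taking a product of gradients or a Hessian for
  \<open>M\<close> expresses \<open>grad_pairing\<close> and the Laplacian in the frame.\<close>

lemma frame_sum:
  fixes M :: "'n::finite \<Rightarrow> 'n \<Rightarrow> complex" and a b e1 e2 e3 e4 :: "real^'n"
  defines "q \<equiv> \<lambda>v :: real^'n. \<Sum>j\<in>UNIV. \<Sum>l\<in>UNIV. complex_of_real (v $ j) * complex_of_real (v $ l) * M j l"
  assumes frame: "\<And>j l. a $ j * a $ l + b $ j * b $ l + e1 $ j * e1 $ l + e2 $ j * e2 $ l + e3 $ j * e3 $ l + e4 $ j * e4 $ l
      = (if j = l then 1 else 0)"
  shows "q a + q b + q e1 + q e2 + q e3 + q e4 = (\<Sum>j\<in>UNIV. M j j)"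
proof -
  have "q a + q b + q e1 + q e2 + q e3 + q e4 = (\<Sum>j\<in>UNIV. \<Sum>l\<in>UNIV.
     complex_of_real (a $ j * a $ l + b $ j * b $ l + e1 $ j * e1 $ l + e2 $ j * e2 $ l + e3 $ j * e3 $ l + e4 $ j * e4 $ l) * M j l)"
    unfolding q_def by (simp add: sum.distrib[symmetric] algebra_simps)
  also have "\<dots> = (\<Sum>j\<in>UNIV. \<Sum>l\<in>UNIV. if j = l then M j l else 0)"
    unfolding frame by (intro sum.cong refl) auto
  also have "\<dots> = (\<Sum>j\<in>UNIV. M j j)" by simp
  finally show ?thesis .
qed

lemma grad_pairing_frame:
  fixes a b e1 e2 e3 e4 :: "real^'n"
  assumes f: "cpoly_fun f" and g: "cpoly_fun g"
    and frame: "\<And>j l. a $ j * a $ l + b $ j * b $ l + e1 $ j * e1 $ l + e2 $ j * e2 $ l + e3 $ j * e3 $ l + e4 $ j * e4 $ l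
      = (if j = l then 1 else 0)"
  shows "ddir (cvec a) f z * ddir (cvec a) g w + ddir (cvec b) f z * ddir (cvec b) g w
    + ddir (cvec e1) f z * ddir (cvec e1) g w + ddir (cvec e2) f z * ddir (cvec e2) g w
    + ddir (cvec e3) f z * ddir (cvec e3) g w + ddir (cvec e4) f z * ddir (cvec e4) g w
    = grad_pairing f g z w"
proof -
  have q: "(\<Sum>j\<in>UNIV. \<Sum>l\<in>UNIV. complex_of_real (v $ j) * complex_of_real (v $ l) *
      (ddir (axis j 1) f z * ddir (axis l 1) g w)) = ddir (cvec v) f z * ddir (cvec v) g w" for v
    unfolding ddir_expand[OF f, of "cvec v"] ddir_expand[OF g, of "cvec v"] sum_product
    by (simp add: mult_ac)
  show ?thesis
    using frame_sum[OF frame, where M = "\<lambda>j l. ddir (axis j 1) f z * ddir (axis l 1) g w"]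
    unfolding q grad_pairing_def .
qed

lemma laplacian_frame:
  fixes a b e1 e2 e3 e4 :: "real^'n"
  assumes f: "cpoly_fun f"
    and frame: "\<And>j l. a $ j * a $ l + b $ j * b $ l + e1 $ j * e1 $ l + e2 $ j * e2 $ l + e3 $ j * e3 $ l + e4 $ j * e4 $ l
      = (if j = l then 1 else 0)"
  shows "ddir (cvec a) (ddir (cvec a) f) z + ddir (cvec b) (ddir (cvec b) f) z
    + ddir (cvec e1) (ddir (cvec e1) f) z + ddir (cvec e2) (ddir (cvec e2) f) z
    + ddir (cvec e3) (ddir (cvec e3) f) z + ddir (cvec e4) (ddir (cvec e4) f) z
    = (\<Sum>j\<in>UNIV. ddir (axis j 1) (ddir (axis j 1) f) z)"
proof -
  have q: "(\<Sum>j\<in>UNIV. \<Sum>l\<in>UNIV. complex_of_real (v $ j) * complex_of_real (v $ l) *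
      ddir (axis l 1) (ddir (axis j 1) f) z) = ddir (cvec v) (ddir (cvec v) f) z" for v
  proof -
    have "ddir (cvec v) (ddir (cvec v) f) z = (\<Sum>j\<in>UNIV. cvec v $ j * ddir (axis j 1) (ddir (cvec v) f) z)"
      by (rule ddir_expand[OF cpoly_fun_ddir[OF f]])
    also have "\<dots> = (\<Sum>j\<in>UNIV. cvec v $ j * ddir (cvec v) (ddir (axis j 1) f) z)"
      by (simp only: ddir_commute[OF f, of "axis _ 1" "cvec v"])
    also have "\<dots> = (\<Sum>j\<in>UNIV. cvec v $ j * (\<Sum>l\<in>UNIV. cvec v $ l * ddir (axis l 1) (ddir (axis j 1) f) z))"
      by (simp only: ddir_expand[where h = "cvec v", OF cpoly_fun_ddir[OF f]])
    finally show ?thesis by (simp add: sum_distrib_left mult_ac)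
  qed
  show ?thesis
    using frame_sum[OF frame, where M = "\<lambda>j l. ddir (axis l 1) (ddir (axis j 1) f) z"]
    unfolding q .
qed

section \<open>Homogeneity and the reduction to four variables\<close>

text \<open>Differentiate f (t z + s t h) = t^d f (z + s h) at s = 0. Keeping the factor
  \<open>t\<close> on the left avoids the exponent d - 1 and a separate case for
  \<open>d = 0\<close>.\<close>

lemma ddir_homogeneous:
  assumes f: "cpoly_fun f" and hom: "\<And>t z. f (t *s z) = t ^ d * f z"
  shows "t * ddir h f (t *s z) = t ^ d * ddir h f z"
proof -
  have e: "f (t *s z + s *s (t *s h)) = t ^ d * f (z + s *s h)" for s
    unfolding hom[symmetric] by (simp add: vector_add_ldistrib vector_smult_assoc mult.commute)
  have "((\<lambda>s. t ^ d * f (z + s *s h)) has_field_derivative t ^ d * ddir h f z) (at 0)"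
    by (rule DERIV_cmult[OF ddir_has_field_derivative_0[OF f]])
  then have "ddir (t *s h) f (t *s z) = t ^ d * ddir h f z"
    unfolding ddir_def[of "t *s h"] e by (rule DERIV_imp_deriv)
  then show ?thesis by (simp add: ddir_scale_dir[OF f])
qed

lemma ddir_translate_invariant:
  assumes "\<And>z. f (z + n) = f z"
  shows "ddir h f (z + n) = ddir h f z"
proof -
  have "f (z + n + s *s h) = f (z + s *s h)" for s
    using assms[of "z + s *s h"] by (simp add: ac_simps)
  then show ?thesis unfolding ddir_def by simp
qed

lemma grad_pairing_homogeneous:
  assumes f: "cpoly_fun f" "\<And>t z. f (t *s z) = t ^ d * f z"
    and g: "cpoly_fun g" "\<And>t z. g (t *s z) = t ^ e * g z"
  shows "s * t * grad_pairing f g (s *s z) (t *s w) = s ^ d * t ^ e * grad_pairing f g z w"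
proof -
  have "s * t * grad_pairing f g (s *s z) (t *s w) =
     (\<Sum>j\<in>UNIV. (s * ddir (axis j 1) f (s *s z)) * (t * ddir (axis j 1) g (t *s w)))"
    unfolding grad_pairing_def by (simp add: sum_distrib_left mult_ac)
  also have "\<dots> = s ^ d * t ^ e * grad_pairing f g z w"
    unfolding ddir_homogeneous[OF f] ddir_homogeneous[OF g] grad_pairing_def
    by (simp add: sum_distrib_left mult_ac)
  finally show ?thesis .
qed

text \<open>The result for four variables gives the claim on a slice. Invariance along a + \<i> b
  extends it to an affine hyperplane, homogeneity to the complement of a linear hyperplane, and
  density of that complement to all points.\<close>

lemma grad_pairing_zero:
  fixes a b :: "real^'n"
  assumes card: "CARD('n) \<in> {5, 6}" and a: "norm a = 1" and b: "norm b = 1" and ab: "a \<bullet> b = 0"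
    and f: "cpoly_fun f" "\<And>t z. f (t *s z) = t ^ d * f z"
      "\<And>z. ddir (cvec b) f z = \<i> * ddir (cvec a) f z"
      "\<And>z. grad_pairing f f z z = 0" "\<And>z. (\<Sum>j\<in>UNIV. ddir (axis j 1) (ddir (axis j 1) f) z) = 0"
    and g: "cpoly_fun g" "\<And>t z. g (t *s z) = t ^ e * g z"
      "\<And>z. ddir (cvec b) g z = \<i> * ddir (cvec a) g z"
      "\<And>z. grad_pairing g g z z = 0" "\<And>z. (\<Sum>j\<in>UNIV. ddir (axis j 1) (ddir (axis j 1) g) z) = 0"
    and fg: "\<And>z. grad_pairing f g z z = 0"
  shows "grad_pairing f g z w = 0"
proof -
  obtain e1 e2 e3 e4 :: "real^'n" where frame:
    "\<And>j l. a $ j * a $ l + b $ j * b $ l + e1 $ j * e1 $ l + e2 $ j * e2 $ l + e3 $ j * e3 $ l + e4 $ j * e4 $ l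
      = (if j = l then 1 else 0)"
    using orthonormal_frame[OF card a b ab] by blast
  \<comment> \<open>Null coordinates for the frame: the product of the derivatives along
    \<open>E1\<close> and \<open>E4\<close> minus that along \<open>E2\<close> and \<open>E3\<close>
    is the sum of the squared derivatives along \<open>e1\<close> to \<open>e4\<close>.\<close>
  define E1 where "E1 = cvec e1 + \<i> *s cvec e2"
  define E2 where "E2 = cvec e3 + \<i> *s cvec e4"
  define E3 where "E3 = \<i> *s cvec e4 - cvec e3"
  define E4 where "E4 = cvec e1 - \<i> *s cvec e2"
  note E_defs = E1_def E2_def E3_def E4_def
  have E: "ddir E1 p x = ddir (cvec e1) p x + \<i> * ddir (cvec e2) p x"
    "ddir E2 p x = ddir (cvec e3) p x + \<i> * ddir (cvec e4) p x"
    "ddir E3 p x = \<i> * ddir (cvec e4) p x - ddir (cvec e3) p x"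
    "ddir E4 p x = ddir (cvec e1) p x - \<i> * ddir (cvec e2) p x" if "cpoly_fun p" for p x
    using that unfolding E_defs by (simp_all add: ddir_add_dir ddir_diff_dir ddir_scale_dir)
  \<comment> \<open>The terms of \<open>a\<close> and \<open>b\<close> cancel because the square of
    \<i> is -1; the factor 2 comes from polarisation.\<close>
  have pairing: "null_pairing E1 E2 E3 E4 p q x y = 2 * grad_pairing p q x y"
    if p: "cpoly_fun p" "\<And>z. ddir (cvec b) p z = \<i> * ddir (cvec a) p z"
      and q: "cpoly_fun q" "\<And>z. ddir (cvec b) q z = \<i> * ddir (cvec a) q z" for p q x y
    unfolding grad_pairing_frame[OF p(1) q(1) frame, symmetric] null_pairing_def E[OF p(1)] E[OF q(1)] p(2) q(2)
    by (simp add: algebra_simps)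
  have nh: "null_harmonic p E1 E2 E3 E4"
    if p: "cpoly_fun p" "\<And>z. ddir (cvec b) p z = \<i> * ddir (cvec a) p z"
      "\<And>z. grad_pairing p p z z = 0" "\<And>z. (\<Sum>j\<in>UNIV. ddir (axis j 1) (ddir (axis j 1) p) z) = 0" for p
  proof
    show "cpoly_fun p" by fact
    show "ddir E1 p x * ddir E4 p x = ddir E2 p x * ddir E3 p x" for x
      using pairing[OF p(1,2) p(1,2), of x x] p(3)[of x] by (simp add: null_pairing_def mult.commute)
    have "ddir (cvec b) p = (\<lambda>z. \<i> * ddir (cvec a) p z)" using p(2) by auto
    then have "ddir (cvec b) (ddir (cvec b) p) x = \<i> * ddir (cvec b) (ddir (cvec a) p) x" for x
      by (simp add: ddir_cmult cpoly_fun_ddir p(1))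
    moreover have "ddir (cvec b) (ddir (cvec a) p) x = \<i> * ddir (cvec a) (ddir (cvec a) p) x" for x
      unfolding ddir_commute[OF p(1), of "cvec b"]
      using \<open>ddir (cvec b) p = _\<close> by (simp add: ddir_cmult cpoly_fun_ddir p(1))
    ultimately have ab0: "ddir (cvec a) (ddir (cvec a) p) x + ddir (cvec b) (ddir (cvec b) p) x = 0" for x
      by simp
    have c: "ddir k (ddir E1 p) x = ddir (cvec e1) (ddir k p) x + \<i> * ddir (cvec e2) (ddir k p) x"
      "ddir k (ddir E2 p) x = ddir (cvec e3) (ddir k p) x + \<i> * ddir (cvec e4) (ddir k p) x"
      "ddir k (ddir E3 p) x = \<i> * ddir (cvec e4) (ddir k p) x - ddir (cvec e3) (ddir k p) x"
      "ddir k (ddir E4 p) x = ddir (cvec e1) (ddir k p) x - \<i> * ddir (cvec e2) (ddir k p) x" for k x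
      unfolding ddir_commute[OF p(1), of k E1] ddir_commute[OF p(1), of k E2]
        ddir_commute[OF p(1), of k E3] ddir_commute[OF p(1), of k E4]
      by (rule E[OF cpoly_fun_ddir[OF p(1)]])+
    have EE: "ddir E1 (ddir E4 p) x = ddir (cvec e1) (ddir (cvec e1) p) x + ddir (cvec e2) (ddir (cvec e2) p) x"
      "ddir E2 (ddir E3 p) x = - (ddir (cvec e3) (ddir (cvec e3) p) x + ddir (cvec e4) (ddir (cvec e4) p) x)" for x
      unfolding c(4)[of E1] c(3)[of E2]
      unfolding c(1)[of "cvec e1"] c(1)[of "cvec e2"] c(2)[of "cvec e3"] c(2)[of "cvec e4"]
        ddir_commute[OF p(1), of "cvec e2" "cvec e1"] ddir_commute[OF p(1), of "cvec e4" "cvec e3"]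
      by (simp_all add: algebra_simps)
    show "ddir E1 (ddir E4 p) x = ddir E2 (ddir E3 p) x" for x
      using laplacian_frame[OF p(1) frame, of x] p(4)[of x] ab0[of x] unfolding EE
      by (simp add: add_eq_0_iff)
  qed
  \<comment> \<open>Both \<open>f\<close> and \<open>g\<close> have derivative zero along the null
    vector \<open>n\<close>. The linear form \<open>\<phi>\<close> is the bilinear product with
    \<open>n\<close>, and \<open>x0\<close> is half the complex conjugate of \<open>n\<close>,
    normalised to \<open>\<phi> x0 = 1\<close>.\<close>
  define n where "n = cvec a + \<i> *s cvec b"
  define x0 where "x0 = (1/2) *s (cvec a - \<i> *s cvec b)"
  define \<phi> where "\<phi> = (\<lambda>z :: complex^'n. \<Sum>j\<in>UNIV. n $ j * z $ j)"
  have on_slice: "grad_pairing f g x y = 0"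
    if "x \<in> slice4 x0 E1 E2 E3 E4" "y \<in> slice4 x0 E1 E2 E3 E4" for x y
  proof -
    have "null_pairing E1 E2 E3 E4 f g x y = 0"
    proof (rule null_pairing_zero_on_slice[OF nh nh _ that])
      show "null_pairing E1 E2 E3 E4 f g x x = 0" for x
        unfolding pairing[OF f(1,3) g(1,3)] by (simp add: fg)
    qed (use f g in auto)
    then show ?thesis unfolding pairing[OF f(1,3) g(1,3)] by simp
  qed
  have reach: "\<exists>t. x + t *s n \<in> slice4 x0 E1 E2 E3 E4" if x: "\<phi> x = 1" for x
  proof -
    define c where "c = (\<lambda>v :: real^'n. \<Sum>l\<in>UNIV. v $ l * x $ l)"
    have "x = c a *s cvec a + c b *s cvec b + c e1 *s cvec e1 + c e2 *s cvec e2 + c e3 *s cvec e3 + c e4 *s cvec e4"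
      (is "x = ?r")
    proof -
      have "x $ j = ?r $ j" for j
      proof -
        have "x $ j = (\<Sum>l\<in>UNIV. complex_of_real (if j = l then 1 else 0) * x $ l)"
        proof -
          have "x $ j = (\<Sum>l\<in>UNIV. if j = l then x $ l else 0)" by simp
          also have "\<dots> = (\<Sum>l\<in>UNIV. complex_of_real (if j = l then 1 else 0) * x $ l)"
            by (intro sum.cong) auto
          finally show ?thesis .
        qed
        also have "\<dots> = ?r $ j"
          unfolding frame[symmetric] c_def
          by (simp add: sum.distrib sum_distrib_left algebra_simps)
        finally show ?thesis .
      qed
      then show ?thesis by (simp add: vec_eq_iff)
    qed
    moreover have "c a + \<i> * c b = 1"
      using x unfolding \<phi>_def n_def c_def
      by (simp add: sum_distrib_left sum.distrib[symmetric] algebra_simps)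
    then have ca: "c a = 1 - \<i> * c b" by (simp add: algebra_simps)
    \<comment> \<open>This shift along \<open>n\<close> turns the coefficients of \<open>a\<close>
      and \<open>b\<close> into 1/2 and - \<i>/2, which are those of \<open>x0\<close>.\<close>
    ultimately have "x + (\<i> * c b - 1/2) *s n = x0 + (((c e1 - \<i> * c e2) / 2) *s E1 + ((c e3 - \<i> * c e4) / 2) *s E2
        + ((- c e3 - \<i> * c e4) / 2) *s E3 + ((c e1 + \<i> * c e2) / 2) *s E4)"
      unfolding x0_def n_def E_defs
      by (simp add: vec_eq_iff) (simp add: field_simps)
    then show ?thesis unfolding slice4_def by blast
  qed
  have inv: "p (x + t *s n) = p x"
    if p: "cpoly_fun p" "\<And>z. ddir (cvec b) p z = \<i> * ddir (cvec a) p z" for p x t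
    by (rule ddir_zero_imp_constant[OF p(1)])
      (simp add: n_def ddir_add_dir ddir_scale_dir p)
  have one: "grad_pairing f g x y = 0" if "\<phi> x = 1" "\<phi> y = 1" for x y
  proof -
    obtain s t where st: "x + s *s n \<in> slice4 x0 E1 E2 E3 E4" "y + t *s n \<in> slice4 x0 E1 E2 E3 E4"
        using reach[OF \<open>\<phi> x = 1\<close>] reach[OF \<open>\<phi> y = 1\<close>] by blast
    have "ddir h f (x + s *s n) = ddir h f x" "ddir h g (y + t *s n) = ddir h g y" for h
      by (rule ddir_translate_invariant, rule inv, fact, fact)+
    then have "grad_pairing f g x y = grad_pairing f g (x + s *s n) (y + t *s n)"
      unfolding grad_pairing_def
      by simp
    then show ?thesis using on_slice[OF st] by simp
  qed
  have scale: "\<phi> (t *s x) = t * \<phi> x" for t x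
    unfolding \<phi>_def by (simp add: sum_distrib_left mult_ac)
  have nonzero: "grad_pairing f g x y = 0" if "\<phi> x \<noteq> 0" "\<phi> y \<noteq> 0" for x y
  proof -
    have "grad_pairing f g ((1 / \<phi> x) *s x) ((1 / \<phi> y) *s y) = 0"
      using that by (intro one) (simp_all add: scale)
    then have "\<phi> x * \<phi> y * grad_pairing f g (\<phi> x *s ((1 / \<phi> x) *s x)) (\<phi> y *s ((1 / \<phi> y) *s y)) = 0"
      unfolding grad_pairing_homogeneous[OF f(1,2) g(1,2)] by simp
    then show ?thesis using that by (simp add: vector_smult_assoc)
  qed
  have poly_\<phi>: "cpoly_fun \<phi>" unfolding \<phi>_def by (intro cpoly_intros)
  have \<phi>x0: "\<phi> x0 = 1"
  proof -
    have "\<phi> x0 = complex_of_real ((a \<bullet> a + b \<bullet> b) / 2)"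
      unfolding \<phi>_def x0_def n_def inner_vec_def
      by (simp add: sum_distrib_left sum_divide_distrib sum.distrib[symmetric] field_simps)
    then show ?thesis using a b by (simp add: dot_square_norm)
  qed
  have dense: "p x = 0" if "cpoly_fun p" "\<And>x. \<phi> x \<noteq> 0 \<Longrightarrow> p x = 0" for p x
  proof -
    have "(\<forall>x\<in>UNIV. \<phi> x = 0) \<or> (\<forall>x\<in>UNIV. p x = 0)"
      using that(2) by (intro cpoly_zero_product_on poly_\<phi> that(1)) auto
    moreover have "\<not> (\<forall>x\<in>UNIV. \<phi> x = 0)" using \<phi>x0 by (metis UNIV_I zero_neq_one)
    ultimately show ?thesis by blast
  qed
  show ?thesis
  proof (rule dense[where p = "\<lambda>z. grad_pairing f g z w"])
    fix z assume z: "\<phi> z \<noteq> 0"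
    show "grad_pairing f g z w = 0"
    proof (rule dense[where p = "\<lambda>w. grad_pairing f g z w"])
      show "cpoly_fun (\<lambda>w. grad_pairing f g z w)" by (rule cpoly_fun_grad_pairing(2)[OF f(1) g(1)])
    qed (rule nonzero[OF z])
  qed (rule cpoly_fun_grad_pairing(1)[OF f(1) g(1)])
qed

section \<open>The axis of holomorphy\<close>

definition cunit :: "nat \<Rightarrow> complex \<Rightarrow> nat \<Rightarrow> complex" where
  "cunit j c = (\<lambda>i. if i = j then c else 0)"

lemma cunit_in_Cspace: "j < k \<Longrightarrow> cunit j c \<in> Cspace k"
  by (auto simp: cunit_def Cspace_def)

lemma Cnorm_cunit: "j < k \<Longrightarrow> Cnorm k (cunit j c) = cmod c"
proof -
  assume "j < k"
  have "(\<Sum>i<k. (cmod (cunit j c i))\<^sup>2) = (\<Sum>i<k. if i = j then (cmod c)\<^sup>2 else 0)"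
    by (intro sum.cong) (auto simp: cunit_def)
  with \<open>j < k\<close> show ?thesis by (simp add: Cnorm_def L2_set_def)
qed

lemma cunit_add: "(\<lambda>i. cunit j c i + cunit j d i) = cunit j (c + d)"
  by (auto simp: cunit_def)

text \<open>Polarising the norm shows that \<open>\<iota>\<close> preserves inner products.
  Adjointness then identifies each coordinate of the projected vector by testing it against the
  vectors \<open>cunit j d\<close>.\<close>

lemma orthogonal_projection_unit:
  assumes \<iota>: "isometric_embedding k V \<iota>" and k: "0 < k"
    and \<pi>: "\<And>v z. v \<in> V \<Longrightarrow> z \<in> Cspace k \<Longrightarrow> \<iota> z \<bullet> v = (\<Sum>j<k. z j \<bullet> \<pi> v j)"
    and \<pi>C: "\<And>v. v \<in> V \<Longrightarrow> \<pi> v \<in> Cspace k"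
    and V: "\<iota> (cunit 0 c) \<in> V"
  shows "\<pi> (\<iota> (cunit 0 c)) = cunit 0 c"
proof
  fix j
  note isoE = \<iota>[unfolded isometric_embedding_def]
  have n: "norm (\<iota> z) = Cnorm k z" if "z \<in> Cspace k" for z using isoE that by blast
  have add: "\<iota> (\<lambda>i. z i + w i) = \<iota> z + \<iota> w" if "z \<in> Cspace k" "w \<in> Cspace k" for z w
    using isoE that by blast
  have inner: "\<iota> z \<bullet> \<iota> w = (\<Sum>i<k. z i \<bullet> w i)" if z: "z \<in> Cspace k" and w: "w \<in> Cspace k" for z w
  proof -
    have zw: "(\<lambda>i. z i + w i) \<in> Cspace k" using z w by (auto simp: Cspace_def)
    have sq: "(norm (\<iota> u))\<^sup>2 = (\<Sum>i<k. u i \<bullet> u i)" if "u \<in> Cspace k" for u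
      by (simp add: n[OF that] Cnorm_def L2_set_def sum_nonneg dot_square_norm)
    have "(norm (\<iota> z + \<iota> w))\<^sup>2 = (norm (\<iota> z))\<^sup>2 + (norm (\<iota> w))\<^sup>2 + 2 * (\<iota> z \<bullet> \<iota> w)"
      unfolding dot_square_norm[symmetric] by (simp add: inner_add_left inner_add_right inner_commute)
    moreover have "(norm (\<iota> z + \<iota> w))\<^sup>2 = (norm (\<iota> z))\<^sup>2 + (norm (\<iota> w))\<^sup>2 + 2 * (\<Sum>i<k. z i \<bullet> w i)"
      unfolding add[OF z w, symmetric] sq[OF zw] sq[OF z] sq[OF w]
      by (simp add: inner_add_left inner_add_right inner_commute sum.distrib[symmetric] sum_distrib_left algebra_simps)
    ultimately show ?thesis by simp
  qed
  have c: "cunit 0 c \<in> Cspace k" using k by (rule cunit_in_Cspace)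
  have eq: "d \<bullet> \<pi> (\<iota> (cunit 0 c)) j = d \<bullet> cunit 0 c j" if j: "j < k" for d
  proof -
    have d: "cunit j d \<in> Cspace k" using j by (rule cunit_in_Cspace)
    have pick: "(\<Sum>i<k. cunit j d i \<bullet> u i) = d \<bullet> u j" for u
    proof -
      have "(\<Sum>i<k. cunit j d i \<bullet> u i) = (\<Sum>i<k. if i = j then d \<bullet> u i else 0)"
        by (intro sum.cong) (auto simp: cunit_def)
      then show ?thesis using j by simp
    qed
    show ?thesis using \<pi>[OF V d] inner[OF d c] unfolding pick by simp
  qed
  show "\<pi> (\<iota> (cunit 0 c)) j = cunit 0 c j"
  proof (cases "j < k")
    case True
    have "(\<pi> (\<iota> (cunit 0 c)) j - cunit 0 c j) \<bullet> (\<pi> (\<iota> (cunit 0 c)) j - cunit 0 c j) = 0"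
      unfolding inner_diff_right[of _ "\<pi> (\<iota> (cunit 0 c)) j"] eq[OF True] by simp
    then show ?thesis by simp
  next
    case False
    then show ?thesis using \<pi>C[OF V] c by (simp add: Cspace_def)
  qed
qed

text \<open>The derivative at the origin suffices later, because the base point \<open>x\<close> in
  the axis condition is arbitrary.\<close>

lemma holomorphic_Cspace_complex_line:
  assumes G: "holomorphic_Cspace k G" and k: "0 < k"
  obtains \<alpha> where "((\<lambda>t. G (cunit 0 t)) has_field_derivative \<alpha>) (at 0)"
proof -
  have 0: "cunit 0 0 \<in> Cspace k" using k by (rule cunit_in_Cspace)
  then obtain a where a: "\<And>e. e > 0 \<Longrightarrow> \<exists>d>0. \<forall>h\<in>Cspace k. Cnorm k h < d \<longrightarrow>
        cmod (G (\<lambda>i. cunit 0 0 i + h i) - G (cunit 0 0) - (\<Sum>j<k. a j * h j)) \<le> e * Cnorm k h"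
    using G unfolding holomorphic_Cspace_def by blast
  have s: "(\<Sum>j<k. a j * cunit 0 t j) = a 0 * t" for t
  proof -
    have "(\<Sum>j<k. a j * cunit 0 t j) = (\<Sum>j<k. if j = 0 then a 0 * t else 0)"
      by (intro sum.cong) (auto simp: cunit_def)
    then show ?thesis using k by simp
  qed
  have "((\<lambda>t. G (cunit 0 t)) has_derivative (\<lambda>t. a 0 * t)) (at 0)"
    unfolding has_derivative_at_alt
  proof (intro conjI allI impI bounded_linear_mult_right)
    fix e :: real assume "e > 0"
    from a[OF this] obtain d where d: "d > 0" "\<And>h. h \<in> Cspace k \<Longrightarrow> Cnorm k h < d \<Longrightarrow>
        cmod (G (\<lambda>i. cunit 0 0 i + h i) - G (cunit 0 0) - (\<Sum>j<k. a j * h j)) \<le> e * Cnorm k h" by blast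
    have "cmod (G (cunit 0 t) - G (cunit 0 0) - a 0 * (t - 0)) \<le> e * cmod (t - 0)" if "cmod (t - 0) < d" for t
      using d(2)[OF cunit_in_Cspace[OF k, of t]] that unfolding cunit_add Cnorm_cunit[OF k] s by simp
    with d(1) show "\<exists>d>0. \<forall>y. cmod (y - 0) < d \<longrightarrow> cmod (G (cunit 0 y) - G (cunit 0 0) - a 0 * (y - 0)) \<le> e * cmod (y - 0)"
      by blast
  qed
  then show thesis by (intro that[of "a 0"]) (simp add: has_field_derivative_def)
qed

lemma ddir_real_line:
  assumes f: "cpoly_fun f"
  shows "((\<lambda>t::real. f (cvec (x + t *\<^sub>R v))) has_vector_derivative ddir (cvec v) f (cvec x)) (at 0)"
proof -
  have "((\<lambda>t::real. f (cvec x + complex_of_real t *s cvec v)) has_vector_derivative ddir (cvec v) f (cvec x)) (at 0)"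
    using ddir_has_field_derivative_0[OF f, of "cvec x" "cvec v"]
    by (intro has_vector_derivative_real_field) simp
  then show ?thesis by (simp add: cvec_add cvec_scaleR)
qed

text \<open>For k > 0, \<open>a\<close> and \<open>b\<close> are the images of 1 and \<i> in the
  first complex coordinate, and the equation is the Cauchy-Riemann equation. For k = 0 every member
  is constant along V, so any two orthonormal vectors of V serve; the bound on \<open>dim V\<close>
  provides them.\<close>

lemma uniform_axis_cauchy_riemann:
  fixes \<F> :: "(real^'n::finite \<Rightarrow> complex) set"
  assumes "uniform_axis_of_holomorphy V \<F>" and dim: "dim V \<ge> 2"
  obtains a b where "norm a = 1" "norm b = 1" "a \<bullet> b = 0"
    "\<And>f z. cpoly_fun f \<Longrightarrow> (\<lambda>x. f (cvec x)) \<in> \<F> \<Longrightarrow> ddir (cvec b) f z = \<i> * ddir (cvec a) f z"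
proof -
  obtain k \<pi> \<G> \<iota> where V: "subspace V" and \<iota>: "isometric_embedding k V \<iota>"
    and \<pi>: "\<And>v. v \<in> V \<Longrightarrow> \<pi> v \<in> Cspace k"
      "\<And>v z. v \<in> V \<Longrightarrow> z \<in> Cspace k \<Longrightarrow> \<iota> z \<bullet> v = (\<Sum>j<k. z j \<bullet> \<pi> v j)"
    and \<G>: "\<And>G. G \<in> \<G> \<Longrightarrow> holomorphic_Cspace k G"
    and eq: "{restrict (\<lambda>v. F (x + v)) V | x F. F \<in> \<F>} = {restrict (\<lambda>v. G (\<pi> v)) V | G. G \<in> \<G>}"
    using assms(1)
    unfolding uniform_axis_of_holomorphy_def uniformly_complex_type_def orthogonal_projection_def
    by (elim conjE exE) (rule that, auto)
  have rep: "\<exists>G\<in>\<G>. \<forall>v\<in>V. F (x + v) = G (\<pi> v)" if "F \<in> \<F>" for F x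
  proof -
    have "restrict (\<lambda>v. F (x + v)) V \<in> {restrict (\<lambda>v. G (\<pi> v)) V | G. G \<in> \<G>}"
      unfolding eq[symmetric] using that by blast
    then show ?thesis by (auto simp: fun_eq_iff restrict_def) metis
  qed
  have extend: "ddir (cvec b) f z = \<i> * ddir (cvec a) f z"
    if f: "cpoly_fun f" and CR: "\<And>x. ddir (cvec b) f (cvec x) = \<i> * ddir (cvec a) f (cvec x)" for a b f z
  proof -
    have "ddir (cvec b) f z - \<i> * ddir (cvec a) f z = 0"
      by (rule cpoly_zero_if_zero_on_reals[where f = "\<lambda>z. ddir (cvec b) f z - \<i> * ddir (cvec a) f z"])
        (intro cpoly_intros cpoly_fun_ddir f, simp add: CR)
    then show ?thesis by simp
  qed
  show thesis
  proof (cases "k = 0")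
    case True
    obtain B where B: "B \<subseteq> V" "pairwise orthogonal B" "\<And>x. x \<in> B \<Longrightarrow> norm x = 1" "card B = dim V"
      using V by (rule orthonormal_basis_subspace) (rule that)
    have card: "2 \<le> card B" using B(4) dim by simp
    then have "finite B" using card.infinite[of B] by fastforce
    then obtain a b where ab: "a \<in> B" "b \<in> B" "a \<noteq> b"
      using card card_le_Suc0_iff_eq[of B] by auto
    show thesis
    proof (rule that[of a b])
      show "norm a = 1" "norm b = 1" "a \<bullet> b = 0"
        using ab B by (auto simp: pairwise_def orthogonal_def)
      fix f :: "complex^'n \<Rightarrow> complex" and z
      assume f: "cpoly_fun f" and F: "(\<lambda>x. f (cvec x)) \<in> \<F>"
      have zero: "ddir (cvec v) f (cvec x) = 0" if v: "v \<in> V" for v x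
      proof -
        obtain G where "\<And>v. v \<in> V \<Longrightarrow> f (cvec (x + v)) = G (\<pi> v)" using rep[OF F] by blast
        moreover have "\<pi> v = (\<lambda>_. 0)" if "v \<in> V" for v
          using \<pi>(1)[OF that] True by (auto simp: Cspace_def)
        ultimately have "(\<lambda>t. f (cvec (x + t *\<^sub>R v))) = (\<lambda>t. G (\<lambda>_. 0))"
          using v V by (auto simp: subspace_scale)
        then have "((\<lambda>t::real. G (\<lambda>_. 0)) has_vector_derivative ddir (cvec v) f (cvec x)) (at 0)"
          using ddir_real_line[OF f, of x v] by (simp only:)
        then show ?thesis by (rule vector_derivative_unique_at[OF _ has_vector_derivative_const])
      qed
      have "a \<in> V" "b \<in> V" using ab B by auto
      then show "ddir (cvec b) f z = \<i> * ddir (cvec a) f z"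
        using extend[OF f, of b a z] zero by simp
    qed
  next
    case False
    then have k: "0 < k" by simp
    note isoE = \<iota>[unfolded isometric_embedding_def]
    have C: "cunit 0 c \<in> Cspace k" for c using k by (rule cunit_in_Cspace)
    define a where "a = \<iota> (cunit 0 1)"
    define b where "b = \<iota> (cunit 0 \<i>)"
    have aV: "a \<in> V" and bV: "b \<in> V" and na: "norm a = 1" and nb: "norm b = 1"
      using isoE C by (auto simp: a_def b_def Cnorm_cunit[OF k])
    have \<pi>\<iota>: "\<pi> (\<iota> (cunit 0 c)) = cunit 0 c" for c
      using isoE C by (intro orthogonal_projection_unit[OF \<iota> k] \<pi>) auto
    have ab: "a \<bullet> b = 0"
    proof -
      have "a \<bullet> b = (\<Sum>j<k. cunit 0 1 j \<bullet> cunit 0 \<i> j)"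
        using \<pi>(2)[OF bV C, of 1] unfolding a_def b_def \<pi>\<iota> .
      also have "\<dots> = 0" by (intro sum.neutral) (auto simp: cunit_def inner_complex_def)
      finally show ?thesis .
    qed
    have ta: "t *\<^sub>R a = \<iota> (cunit 0 (complex_of_real t))" and tb: "t *\<^sub>R b = \<iota> (cunit 0 (complex_of_real t * \<i>))" for t
    proof -
      have "\<iota> (\<lambda>i. t *\<^sub>R cunit 0 c i) = t *\<^sub>R \<iota> (cunit 0 c)" for c using isoE C by blast
      moreover have "(\<lambda>i. t *\<^sub>R cunit 0 c i) = cunit 0 (t *\<^sub>R c)" for c by (auto simp: cunit_def)
      ultimately have "t *\<^sub>R \<iota> (cunit 0 c) = \<iota> (cunit 0 (t *\<^sub>R c))" for c by simp
      then show "t *\<^sub>R a = \<iota> (cunit 0 (complex_of_real t))" "t *\<^sub>R b = \<iota> (cunit 0 (complex_of_real t * \<i>))"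
        unfolding a_def b_def by (simp_all add: scaleR_conv_of_real)
    qed
    show thesis
    proof (rule that[OF na nb ab])
      fix f :: "complex^'n \<Rightarrow> complex" and z
      assume f: "cpoly_fun f" and F: "(\<lambda>x. f (cvec x)) \<in> \<F>"
      show "ddir (cvec b) f z = \<i> * ddir (cvec a) f z"
      proof (rule extend[OF f])
        fix x
        obtain G where G: "G \<in> \<G>" "\<And>v. v \<in> V \<Longrightarrow> f (cvec (x + v)) = G (\<pi> v)" using rep[OF F] by blast
        obtain \<alpha> where \<alpha>: "((\<lambda>t. G (cunit 0 t)) has_field_derivative \<alpha>) (at 0)"
          using \<G>[OF G(1)] k by (rule holomorphic_Cspace_complex_line)
        have fa: "f (cvec (x + t *\<^sub>R a)) = G (cunit 0 (complex_of_real t))" for t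
          using G(2)[OF subspace_scale[OF V aV, of t]] by (simp add: ta \<pi>\<iota>)
        have fb: "f (cvec (x + t *\<^sub>R b)) = G (cunit 0 (complex_of_real t * \<i>))" for t
          using G(2)[OF subspace_scale[OF V bV, of t]] by (simp add: tb \<pi>\<iota>)
        have "((\<lambda>t::real. G (cunit 0 (complex_of_real t))) has_vector_derivative \<alpha>) (at 0)"
          using \<alpha> by (intro has_vector_derivative_real_field) simp
        then have da: "ddir (cvec a) f (cvec x) = \<alpha>"
          by (rule vector_derivative_unique_at[OF ddir_real_line[OF f, of x a, unfolded fa]])
        have "((\<lambda>t. t * \<i>) has_field_derivative \<i>) (at 0)"
          by (auto intro!: derivative_eq_intros)
        then have "((\<lambda>t. G (cunit 0 (t * \<i>))) has_field_derivative \<alpha> * \<i>) (at 0)"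
          using DERIV_chain2[of "\<lambda>t. G (cunit 0 t)" \<alpha> "\<lambda>t. t * \<i>" 0 \<i> UNIV] \<alpha> by simp
        then have "((\<lambda>t::real. G (cunit 0 (complex_of_real t * \<i>))) has_vector_derivative \<alpha> * \<i>) (at 0)"
          by (intro has_vector_derivative_real_field) simp
        then have "ddir (cvec b) f (cvec x) = \<alpha> * \<i>"
          by (rule vector_derivative_unique_at[OF ddir_real_line[OF f, of x b, unfolded fb]])
        with da show "ddir (cvec b) f (cvec x) = \<i> * ddir (cvec a) f (cvec x)" by simp
      qed
    qed
  qed
qed

section \<open>Isotropic gradients\<close>

text \<open>The Hermitian product, antilinear in the second argument. It permits orthonormalisation
  inside isotropic subspaces, where \<open>bilinear_dot\<close> vanishes.\<close>

definition herm :: "complex^'n::finite \<Rightarrow> complex^'n \<Rightarrow> complex" where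
  "herm u v = (\<Sum>l\<in>UNIV. u $ l * cnj (v $ l))"

lemma herm_simps:
  "herm (u + v) x = herm u x + herm v x" "herm (u - v) x = herm u x - herm v x"
  "herm (c *s u) x = c * herm u x" "herm x (c *s u) = cnj c * herm x u"
  "herm (\<Sum>j\<in>J. p j) x = (\<Sum>j\<in>J. herm (p j) x)"
proof -
  show "herm (\<Sum>j\<in>J. p j) x = (\<Sum>j\<in>J. herm (p j) x)"
    by (induction J rule: infinite_finite_induct)
      (auto simp: herm_def algebra_simps sum.distrib)
qed (auto simp: herm_def algebra_simps sum.distrib sum_subtractf sum_distrib_left)

lemma herm_commute: "herm u v = cnj (herm v u)"
  by (simp add: herm_def mult.commute)

lemma herm_self: "herm u u = complex_of_real ((norm u)\<^sup>2)"
  by (simp add: herm_def norm_vec_def L2_set_def sum_nonneg complex_norm_square[symmetric])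

definition vRe :: "complex^'n \<Rightarrow> real^'n" where "vRe u = (\<chi> l. Re (u $ l))"
definition vIm :: "complex^'n \<Rightarrow> real^'n" where "vIm u = (\<chi> l. Im (u $ l))"

lemma vRe_vIm: "u = cvec (vRe u) + \<i> *s cvec (vIm u)"
  by (simp add: vec_eq_iff vRe_def vIm_def complex_eq_iff)

text \<open>Real and imaginary parts of the two products give four linear equations for the four
  real inner products. Vectors of Hermitian square 2 thus have real and imaginary parts of length
  1.\<close>

lemma isotropic_real_parts:
  fixes r :: real
  assumes "bilinear_dot u v = 0" "herm u v = complex_of_real (2 * r)"
  shows "vRe u \<bullet> vRe v = r" "vIm u \<bullet> vIm v = r" "vRe u \<bullet> vIm v = 0"
proof -
  have b: "bilinear_dot u v = Complex (vRe u \<bullet> vRe v - vIm u \<bullet> vIm v) (vRe u \<bullet> vIm v + vIm u \<bullet> vRe v)"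
    by (simp add: bilinear_dot_def inner_vec_def vRe_def vIm_def complex_eq_iff sum.distrib sum_subtractf)
  have h: "herm u v = Complex (vRe u \<bullet> vRe v + vIm u \<bullet> vIm v) (vIm u \<bullet> vRe v - vRe u \<bullet> vIm v)"
    by (simp add: herm_def inner_vec_def vRe_def vIm_def complex_eq_iff sum.distrib sum_subtractf)
  show "vRe u \<bullet> vRe v = r" "vIm u \<bullet> vIm v = r" "vRe u \<bullet> vIm v = 0"
    using assms unfolding b h by (auto simp: complex_eq_iff)
qed

text \<open>Take a longest Hermitian orthogonal system in \<open>W\<close> with squares 2. Its
  length is bounded because the real parts are orthonormal, and it spans \<open>W\<close> because a
  nonzero remainder could be rescaled and appended.\<close>

lemma isotropic_subspace_basis:
  fixes W :: "(complex^'n::finite) set"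
  assumes W: "vec.subspace W" and iso: "\<And>u v. u \<in> W \<Longrightarrow> v \<in> W \<Longrightarrow> bilinear_dot u v = 0"
  obtains k :: nat and a b :: "nat \<Rightarrow> real^'n" where
    "\<And>i j. i < k \<Longrightarrow> j < k \<Longrightarrow> a i \<bullet> a j = (if i = j then 1 else 0)"
    "\<And>i j. i < k \<Longrightarrow> j < k \<Longrightarrow> b i \<bullet> b j = (if i = j then 1 else 0)"
    "\<And>i j. i < k \<Longrightarrow> j < k \<Longrightarrow> a i \<bullet> b j = 0"
    "\<And>u. u \<in> W \<Longrightarrow> \<exists>c. u = (\<Sum>j<k. c j *s (cvec (a j) + \<i> *s cvec (b j)))"
proof -
  define ok where "ok = (\<lambda>(k::nat) w. \<forall>i<k. w i \<in> W \<and> (\<forall>j<k. herm (w i) (w j) = (if i = j then 2 else 0)))"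
  have real_parts: "vRe (w i) \<bullet> vRe (w j) = (if i = j then 1 else 0)"
    "vIm (w i) \<bullet> vIm (w j) = (if i = j then 1 else 0)" "vRe (w i) \<bullet> vIm (w j) = 0"
    if "ok k w" "i < k" "j < k" for k i j :: nat and w
  proof -
    have "bilinear_dot (w i) (w j) = 0" "herm (w i) (w j) = complex_of_real (2 * (if i = j then 1 else 0))"
      using that iso unfolding ok_def by auto
    from isotropic_real_parts[OF this] show "vRe (w i) \<bullet> vRe (w j) = (if i = j then 1 else 0)"
      "vIm (w i) \<bullet> vIm (w j) = (if i = j then 1 else 0)" "vRe (w i) \<bullet> vIm (w j) = 0" by blast+
  qed
  have bound: "k \<le> CARD('n)" if ok: "\<exists>w. ok k w" for k
  proof -
    obtain w where w: "ok k w" using ok by blast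
    let ?S = "(\<lambda>i. vRe (w i)) ` {..<k}"
    have inj: "inj_on (\<lambda>i. vRe (w i)) {..<k}"
    proof (rule inj_onI)
      fix i j assume ij: "i \<in> {..<k}" "j \<in> {..<k}" "vRe (w i) = vRe (w j)"
      show "i = j"
        using real_parts(1)[OF w, of i i] real_parts(1)[OF w, of i j] ij by (auto split: if_splits)
    qed
    have "pairwise orthogonal ?S"
      using real_parts(1)[OF w] by (auto simp: pairwise_def orthogonal_def split: if_splits)
    moreover have "0 \<notin> ?S"
    proof
      assume "0 \<in> ?S"
      then obtain i where "i < k" "vRe (w i) = 0" by auto
      then show False using real_parts(1)[OF w, of i i] by simp
    qed
    ultimately have "independent ?S" by (rule pairwise_orthogonal_independent)
    then have "card ?S \<le> CARD('n)" using independent_bound[of ?S] by simp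
    then show ?thesis by (simp add: card_image[OF inj])
  qed
  define k where "k = (GREATEST k. \<exists>w. ok k w)"
  have "\<exists>w. ok 0 w" by (simp add: ok_def)
  then have ex: "\<exists>w. ok k w" unfolding k_def by (rule GreatestI_nat) (rule bound)
  have max: "m \<le> k" if "\<exists>w. ok m w" for m
    unfolding k_def using that by (rule Greatest_le_nat) (rule bound)
  obtain w where w: "ok k w" using ex by blast
  have wW: "w i \<in> W" if "i < k" for i using w that unfolding ok_def by blast
  have ww: "herm (w i) (w j) = (if i = j then 2 else 0)" if "i < k" "j < k" for i j
    using w that unfolding ok_def by blast
  have expand: "u = (\<Sum>j<k. (herm u (w j) / 2) *s w j)" if u: "u \<in> W" for u
  proof (rule ccontr)
    define r where "r = u - (\<Sum>j<k. (herm u (w j) / 2) *s w j)"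
    assume "u \<noteq> (\<Sum>j<k. (herm u (w j) / 2) *s w j)"
    then have r0: "r \<noteq> 0" by (simp add: r_def)
    have rW: "r \<in> W" unfolding r_def
      by (intro vec.subspace_diff vec.subspace_sum vec.subspace_scale W u wW) auto
    have rw: "herm r (w i) = 0" if "i < k" for i
    proof -
      have "herm r (w i) = herm u (w i) - (\<Sum>j<k. herm u (w j) / 2 * herm (w j) (w i))"
        by (simp add: r_def herm_simps)
      also have "(\<Sum>j<k. herm u (w j) / 2 * herm (w j) (w i)) = (\<Sum>j<k. if j = i then herm u (w i) else 0)"
        using that by (intro sum.cong refl) (simp add: ww)
      finally show ?thesis using that by simp
    qed
    have wr: "herm (w i) r = 0" if "i < k" for i
      using rw[OF that] herm_commute[of "w i" r] by simp
    define s where "s = complex_of_real (sqrt 2 / norm r)"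
    define w' where "w' = w(k := s *s r)"
    have "herm (s *s r) (s *s r) = complex_of_real ((sqrt 2 / norm r)\<^sup>2 * (norm r)\<^sup>2)"
      unfolding herm_simps(3,4) herm_self[of r] s_def complex_cnj_complex_of_real of_real_mult[symmetric]
      by (simp only: power2_eq_square mult.assoc)
    also have "(sqrt 2 / norm r)\<^sup>2 * (norm r)\<^sup>2 = 2" using r0 by (simp add: power_divide)
    finally have ss: "herm (s *s r) (s *s r) = 2" by simp
    have "ok (Suc k) w'" unfolding ok_def
    proof (intro allI impI conjI)
      fix i assume i: "i < Suc k"
      show "w' i \<in> W"
        using i wW vec.subspace_scale[OF W rW, of s] by (cases "i = k") (auto simp: w'_def)
      fix j assume j: "j < Suc k"
      consider "i = k" "j = k" | "i = k" "j < k" | "i < k" "j = k" | "i < k" "j < k"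
        using i j by linarith
      then show "herm (w' i) (w' j) = (if i = j then 2 else 0)"
      proof cases
        case 1
        then show ?thesis by (simp add: w'_def ss)
      next
        case 2
        then show ?thesis by (simp add: w'_def herm_simps(3) rw)
      next
        case 3
        then show ?thesis by (simp add: w'_def herm_simps(4) wr)
      next
        case 4
        then show ?thesis by (simp add: w'_def ww)
      qed
    qed
    then have "Suc k \<le> k" using max by blast
    then show False by simp
  qed
  show thesis
  proof (rule that[of k "\<lambda>i. vRe (w i)" "\<lambda>i. vIm (w i)"])
    fix u assume "u \<in> W"
    then have "u = (\<Sum>j<k. (herm u (w j) / 2) *s (cvec (vRe (w j)) + \<i> *s cvec (vIm (w j))))"
      unfolding vRe_vIm[symmetric] by (rule expand)
    then show "\<exists>c. u = (\<Sum>j<k. c j *s (cvec (vRe (w j)) + \<i> *s cvec (vIm (w j))))"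
      by (rule exI[of _ "\<lambda>j. herm u (w j) / 2"])
  qed (use real_parts[OF w] in auto)
qed

lemma bilinear_dot_span:
  assumes S: "\<And>u v. u \<in> S \<Longrightarrow> v \<in> S \<Longrightarrow> bilinear_dot u v = 0"
    and "u \<in> vec.span S" "v \<in> vec.span S"
  shows "bilinear_dot u v = 0"
proof -
  have sub: "vec.subspace {u. \<forall>v\<in>T. bilinear_dot u v = 0}" for T :: "(complex^'a) set"
    unfolding vec.subspace_def bilinear_dot_def
    by (auto simp: algebra_simps sum.distrib sum_distrib_left[symmetric])
  have comm: "bilinear_dot x y = bilinear_dot y x" for x y :: "complex^'a"
    by (simp add: bilinear_dot_def mult.commute)
  have 1: "vec.span S \<subseteq> {u. \<forall>v\<in>S. bilinear_dot u v = 0}"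
    by (rule vec.span_minimal[OF _ sub]) (use S in auto)
  have "vec.span S \<subseteq> {u. \<forall>v\<in>vec.span S. bilinear_dot u v = 0}"
  proof (rule vec.span_minimal[OF _ sub], rule subsetI, rule CollectI, rule ballI)
    fix x v assume "x \<in> S" "v \<in> vec.span S"
    then show "bilinear_dot x v = 0" using 1 comm[of x v] by auto
  qed
  then show ?thesis using assms by blast
qed

text \<open>All gradients lie in one isotropic subspace with basis a_j + \<i> b_j, and the bilinear
  product with this vector is the j-th coordinate of \<open>\<pi>\<close>. Every differential is
  therefore a complex combination of these coordinates, which makes the members holomorphic on the
  image of \<open>\<iota>\<close> and constant along the kernel of \<open>\<pi>\<close>.\<close>

lemma uniformly_complex_type_if_isotropic:
  fixes \<F> :: "(real^'n::finite \<Rightarrow> complex) set"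
  assumes poly: "\<And>F. F \<in> \<F> \<Longrightarrow> \<exists>f. cpoly_fun f \<and> F = (\<lambda>x. f (cvec x))"
    and iso: "\<And>f g z w. cpoly_fun f \<Longrightarrow> (\<lambda>x. f (cvec x)) \<in> \<F> \<Longrightarrow> cpoly_fun g \<Longrightarrow>
      (\<lambda>x. g (cvec x)) \<in> \<F> \<Longrightarrow> grad_pairing f g z w = 0"
  shows "uniformly_complex_type UNIV \<F>"
proof -
  define D :: "(complex^'n \<Rightarrow> complex) \<Rightarrow> complex^'n \<Rightarrow> complex^'n"
    where "D = (\<lambda>f z. \<chi> j. ddir (axis j 1) f z)"
  define S where "S = {D f z | f z. cpoly_fun f \<and> (\<lambda>x. f (cvec x)) \<in> \<F>}"
  have "bilinear_dot u v = 0" if "u \<in> S" "v \<in> S" for u v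
    using that iso by (auto simp: S_def D_def bilinear_dot_def grad_pairing_def)
  then have isoW: "bilinear_dot u v = 0" if "u \<in> vec.span S" "v \<in> vec.span S" for u v
    using that by (rule bilinear_dot_span)
  obtain k :: nat and a b :: "nat \<Rightarrow> real^'n" where
    aa: "\<And>i j. i < k \<Longrightarrow> j < k \<Longrightarrow> a i \<bullet> a j = (if i = j then 1 else 0)" and
    bb: "\<And>i j. i < k \<Longrightarrow> j < k \<Longrightarrow> b i \<bullet> b j = (if i = j then 1 else 0)" and
    ab: "\<And>i j. i < k \<Longrightarrow> j < k \<Longrightarrow> a i \<bullet> b j = 0" and
    W: "\<And>u. u \<in> vec.span S \<Longrightarrow> \<exists>c. u = (\<Sum>j<k. c j *s (cvec (a j) + \<i> *s cvec (b j)))"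
    by (rule isotropic_subspace_basis[OF vec.subspace_span[of S]], rule isoW, assumption, assumption, rule that)
  define \<iota> where "\<iota> = (\<lambda>z :: nat \<Rightarrow> complex. \<Sum>j<k. Re (z j) *\<^sub>R a j + Im (z j) *\<^sub>R b j)"
  define \<pi> where "\<pi> = (\<lambda>v j. if j < k then Complex (a j \<bullet> v) (b j \<bullet> v) else 0)"
  have ai: "a i \<bullet> \<iota> z = Re (z i)" and bi: "b i \<bullet> \<iota> z = Im (z i)" if i: "i < k" for i z
  proof -
    have "a i \<bullet> \<iota> z = (\<Sum>j<k. if i = j then Re (z j) else 0)"
      unfolding \<iota>_def inner_sum_right
      using i by (intro sum.cong refl) (auto simp: inner_add_right aa ab)
    then show "a i \<bullet> \<iota> z = Re (z i)" using i by simp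
    have "b i \<bullet> \<iota> z = (\<Sum>j<k. if i = j then Im (z j) else 0)"
      unfolding \<iota>_def inner_sum_right
      using i by (intro sum.cong refl) (auto simp: inner_add_right bb ab inner_commute[of "b i" "a _"])
    then show "b i \<bullet> \<iota> z = Im (z i)" using i by simp
  qed
  have adj: "\<iota> z \<bullet> v = (\<Sum>j<k. z j \<bullet> \<pi> v j)" for z v
    unfolding \<iota>_def inner_sum_left
    by (intro sum.cong refl) (auto simp: \<pi>_def inner_add_left inner_complex_def)
  have \<pi>\<iota>: "\<pi> (\<iota> z) j = z j" if "j < k" for z j
    using that by (simp add: \<pi>_def ai bi complex_eq_iff)
  have norm_\<iota>: "norm (\<iota> z) = Cnorm k z" for z
  proof -
    have "\<iota> z \<bullet> \<iota> z = (\<Sum>j<k. (cmod (z j))\<^sup>2)"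
      unfolding adj by (intro sum.cong refl) (simp add: \<pi>\<iota> dot_square_norm)
    then show ?thesis by (simp add: norm_eq_sqrt_inner Cnorm_def L2_set_def)
  qed
  have add_\<iota>: "\<iota> (\<lambda>i. z i + w i) = \<iota> z + \<iota> w" for z w
    unfolding \<iota>_def by (simp add: sum.distrib[symmetric] scaleR_add_left algebra_simps)
  have scale_\<iota>: "\<iota> (\<lambda>i. r *\<^sub>R z i) = r *\<^sub>R \<iota> z" for z r
    unfolding \<iota>_def by (simp add: scaleR_sum_right scaleR_add_right)
  have proj: "orthogonal_projection UNIV k \<pi>"
    unfolding orthogonal_projection_def isometric_embedding_def
    by (intro exI[of _ \<iota>]) (auto simp: norm_\<iota> add_\<iota> scale_\<iota> adj \<pi>_def Cspace_def)
  have grad: "\<exists>c. \<forall>h. ddir (cvec h) f z = (\<Sum>j<k. c j * \<pi> h j)"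
    if f: "cpoly_fun f" "(\<lambda>x. f (cvec x)) \<in> \<F>" for f z
  proof -
    have "D f z \<in> vec.span S" using f by (intro vec.span_base) (auto simp: S_def)
    then obtain c where c: "D f z = (\<Sum>j<k. c j *s (cvec (a j) + \<i> *s cvec (b j)))" using W by blast
    have "ddir (cvec h) f z = (\<Sum>j<k. c j * \<pi> h j)" for h
    proof -
      have "ddir (cvec h) f z = (\<Sum>l\<in>UNIV. cvec h $ l * D f z $ l)"
        unfolding ddir_expand[OF f(1), of "cvec h"] D_def by simp
      also have "\<dots> = (\<Sum>l\<in>UNIV. \<Sum>j<k. c j * ((cvec (a j) $ l + \<i> * cvec (b j) $ l) * cvec h $ l))"
        unfolding c by (simp add: sum_distrib_left algebra_simps)
      also have "\<dots> = (\<Sum>j<k. c j * (\<Sum>l\<in>UNIV. (cvec (a j) $ l + \<i> * cvec (b j) $ l) * cvec h $ l))"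
        by (subst sum.swap) (simp add: sum_distrib_left)
      also have "\<dots> = (\<Sum>j<k. c j * \<pi> h j)"
        by (intro sum.cong refl) (simp add: \<pi>_def inner_vec_def complex_eq_iff)
      finally show ?thesis .
    qed
    then show ?thesis by blast
  qed
  have hol: "holomorphic_Cspace k (\<lambda>z. F (\<iota> z))" if F: "F \<in> \<F>" for F
    unfolding holomorphic_Cspace_def
  proof
    fix z assume "z \<in> Cspace k"
    obtain f where f: "cpoly_fun f" "F = (\<lambda>x. f (cvec x))" using poly[OF F] by blast
    obtain c where c: "\<And>h. ddir (cvec h) f (cvec (\<iota> z)) = (\<Sum>j<k. c j * \<pi> h j)"
      using grad[of f "cvec (\<iota> z)"] f F by blast
    have c\<iota>: "ddir (cvec (\<iota> h)) f (cvec (\<iota> z)) = (\<Sum>j<k. c j * h j)" for h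
      unfolding c by (intro sum.cong refl) (simp add: \<pi>\<iota>)
    show "\<exists>c. \<forall>e>0. \<exists>d>0. \<forall>h\<in>Cspace k. Cnorm k h < d \<longrightarrow>
        cmod (F (\<iota> (\<lambda>i. z i + h i)) - F (\<iota> z) - (\<Sum>j<k. c j * h j)) \<le> e * Cnorm k h"
    proof (intro exI[of _ c] allI impI)
      fix e :: real assume "e > 0"
      then obtain d where d: "d > 0" "\<And>y. norm (y - \<iota> z) < d \<Longrightarrow>
          cmod (f (cvec y) - f (cvec (\<iota> z)) - ddir (cvec (y - \<iota> z)) f (cvec (\<iota> z))) \<le> e * norm (y - \<iota> z)"
        using cpoly_fun_has_derivative[OF f(1), of "\<iota> z"] unfolding has_derivative_at_alt by blast
      have "cmod (F (\<iota> (\<lambda>i. z i + h i)) - F (\<iota> z) - (\<Sum>j<k. c j * h j)) \<le> e * Cnorm k h"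
        if "Cnorm k h < d" for h
        using d(2)[of "\<iota> z + \<iota> h"] that by (simp add: add_\<iota> norm_\<iota> c\<iota> f(2))
      then show "\<exists>d>0. \<forall>h\<in>Cspace k. Cnorm k h < d \<longrightarrow>
        cmod (F (\<iota> (\<lambda>i. z i + h i)) - F (\<iota> z) - (\<Sum>j<k. c j * h j)) \<le> e * Cnorm k h"
        using d(1) by blast
    qed
  qed
  have factor: "F (\<iota> (\<pi> v)) = F v" if F: "F \<in> \<F>" for F v
  proof -
    obtain f where f: "cpoly_fun f" "F = (\<lambda>x. f (cvec x))" using poly[OF F] by blast
    \<comment> \<open>This vector lies in the kernel of \<open>\<pi>\<close>.\<close>
    define h where "h = v - \<iota> (\<pi> v)"
    have "\<pi> h j = 0" for j
      by (simp add: h_def \<pi>_def inner_diff_right ai bi complex_eq_iff)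
    then have "ddir (cvec h) f z = 0" for z
      using grad[of f z] f F by auto
    then have "f (cvec (\<iota> (\<pi> v)) + 1 *s cvec h) = f (cvec (\<iota> (\<pi> v)))"
      by (intro ddir_zero_imp_constant f)
    moreover have "cvec (\<iota> (\<pi> v)) + 1 *s cvec h = cvec v"
      by (simp add: h_def cvec_add[symmetric])
    ultimately show ?thesis by (simp add: f(2))
  qed
  show ?thesis
    unfolding uniformly_complex_type_def
  proof (intro exI conjI)
    show "orthogonal_projection UNIV k \<pi>" by (rule proj)
    show "\<forall>G\<in>{\<lambda>z. F (\<iota> z) | F. F \<in> \<F>}. holomorphic_Cspace k G" using hol by blast
    have F: "restrict (\<lambda>v. F (\<iota> (\<pi> v))) UNIV = F" if "F \<in> \<F>" for F
      using factor[OF that] by (simp add: restrict_UNIV)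
    show "\<F> = {restrict (\<lambda>v. G (\<pi> v)) UNIV | G. G \<in> {\<lambda>z. F (\<iota> z) | F. F \<in> \<F>}}"
    proof (intro equalityI subsetI)
      fix F assume "F \<in> \<F>"
      then show "F \<in> {restrict (\<lambda>v. G (\<pi> v)) UNIV | G. G \<in> {\<lambda>z. F (\<iota> z) | F. F \<in> \<F>}}"
        by (intro CollectI exI[of _ "\<lambda>z. F (\<iota> z)"] conjI exI[of _ F] F[symmetric] refl)
    next
      fix H assume "H \<in> {restrict (\<lambda>v. G (\<pi> v)) UNIV | G. G \<in> {\<lambda>z. F (\<iota> z) | F. F \<in> \<F>}}"
      then obtain F where "F \<in> \<F>" "H = restrict (\<lambda>v. F (\<iota> (\<pi> v))) UNIV" by blast
      then show "H \<in> \<F>" using F by simp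
    qed
  qed
qed

section \<open>Conclusion in dimensions five and six\<close>

theorem theorem5:
  fixes \<F> :: "(real^'n::finite \<Rightarrow> complex) set"
  assumes "CARD('n) \<in> {5, 6}"
    and "eigenfamily \<F>"
    and "\<forall>F\<in>\<F>. (\<exists>d. homogeneous_polynomial d F) \<and> harmonic_morphism F"
    and "\<exists>V. uniform_axis_of_holomorphy V \<F> \<and> dim V \<ge> 2"
  shows "uniformly_complex_type UNIV \<F>"
proof -
  obtain V where "uniform_axis_of_holomorphy V \<F>" "dim V \<ge> 2" using assms(4) by blast
  then obtain a b where ab: "norm a = 1" "norm b = 1" "a \<bullet> b = 0" and
    CR: "\<And>f z. cpoly_fun f \<Longrightarrow> (\<lambda>x. f (cvec x)) \<in> \<F> \<Longrightarrow> ddir (cvec b) f z = \<i> * ddir (cvec a) f z"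
    by (rule uniform_axis_cauchy_riemann) (rule that)
  \<comment> \<open>Here \<open>f\<close> is any polynomial extending a member of the family. It
    coincides with the homogeneous extension because the two agree at real points.\<close>
  have hom: "\<exists>d. \<forall>t z. f (t *s z) = t ^ d * f z"
    if f: "cpoly_fun f" "(\<lambda>x. f (cvec x)) \<in> \<F>" for f
  proof -
    obtain d where "homogeneous_polynomial d (\<lambda>x. f (cvec x))" using assms(3) f(2) by blast
    then obtain f' where f': "cpoly_fun f'" "(\<lambda>x. f (cvec x)) = (\<lambda>x. f' (cvec x))"
      "\<And>t z. f' (t *s z) = t ^ d * f' z"
      by (rule homogeneous_polynomial_complexify) (rule that)
    have "f z - f' z = 0" for z
      by (rule cpoly_zero_if_zero_on_reals[where f = "\<lambda>z. f z - f' z"])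
        (use f(1) f'(1) fun_cong[OF f'(2)] in \<open>auto intro: cpoly_fun_diff\<close>)
    then have "f = f'" by auto
    then show ?thesis using f'(3) by blast
  qed
  show ?thesis
  proof (rule uniformly_complex_type_if_isotropic)
    fix F assume "F \<in> \<F>"
    then obtain d where "homogeneous_polynomial d F" using assms(3) by blast
    then show "\<exists>f. cpoly_fun f \<and> F = (\<lambda>x. f (cvec x))"
      by (rule homogeneous_polynomial_complexify) blast
  next
    fix f g :: "complex^'n \<Rightarrow> complex" and z w
    assume f: "cpoly_fun f" "(\<lambda>x. f (cvec x)) \<in> \<F>" and g: "cpoly_fun g" "(\<lambda>x. g (cvec x)) \<in> \<F>"
    obtain d where d: "\<And>t z. f (t *s z) = t ^ d * f z" using hom[OF f] by blast
    obtain e where e: "\<And>t z. g (t *s z) = t ^ e * g z" using hom[OF g] by blast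
    show "grad_pairing f g z w = 0"
      by (rule grad_pairing_zero[OF assms(1) ab f(1) d CR[OF f]
            eigenfamily_complexify[OF assms(2) f(2) f(2) f(1) refl f(1) refl]
            g(1) e CR[OF g]
            eigenfamily_complexify[OF assms(2) g(2) g(2) g(1) refl g(1) refl]
            eigenfamily_complexify(1)[OF assms(2) f(2) g(2) f(1) refl g(1) refl]])
  qed
qed

end
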